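(* For every real $\lambda>0$, $$\mathbb{E}^{(d)}_{2n}\left(\exp\left(\lambda\,\frac{\max \mathbf{S}}{\sqrt{2n}}\right)\right)\longrightarrow \mathbb{E}\left(\exp\left(\lambda \max_{t\in[0,1]}\mathsf{e}(t)\right)\right)\quad\text{as } n\to\infty,$$ where $(\mathsf{e}(t),\,t\in[0,1])$ is the normalized Brownian excursion and $\mathbf{S}$ is a uniformly random Dyck path with $2n$ steps. In particular, for every real $\lambda>0$, $$\sup_{n\ge 1}\ \mathbb{E}^{(d)}_{2n}\left(\exp\left(\lambda\, n^{-1/2}\max \mathbf{S}\right)\right)<+\infty .$$
   Context: For $n\in\mathbb{N}=\{0,1,2,\dots\}$, let $\mathcal{W}_n$ be the set of Bernoulli chains with $n$ steps, i.e. integer sequences $\mathbf{S}=(S_i)_{0\le i\le n}$ with $S_0=0$ and $S_{i+1}-S_i\in\{-1,+1\}$ for all $0\le i\le n-1$. The set of Dyck paths with $2n$ steps is $$\mathcal{D}_{2n}=\{\mathbf{S}\in\mathcal{W}_{2n}:\ S_{2n}=0,\ S_i\ge 0 \text{ for all } 0\le i\le 2n\}.$$ $\mathbb{P}^{(d)}_{2n}$ denotes the uniform probability distribution on $\mathcal{D}_{2n}$ and $\mathbb{E}^{(d)}_{2n}$ the corresponding expectation. We write $\max\mathbf{S}=\max_{0\le i\le 2n}S_i$. The normalized Brownian excursion $(\mathsf{e}(t))_{t\in[0,1]}$ is standard Brownian motion on $[0,1]$ conditioned to return to $0$ at time $1$ and to stay positive on $(0,1)$; equivalently, in law, the three-dimensional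 Bessel bridge from $0$ to $0$ of duration $1$. *)

theory Defs
  imports "HOL-Probability.Probability" "HOL-Real_Asymp.Real_Asymp"
begin

section \<open>Dyck paths\<close>

text \<open>A chain \<open>(S\<^sub>0, \<dots>, S\<^sub>n)\<close> is represented by the list of its \<open>n + 1\<close> values.\<close>

definition bernoulli_chains :: "nat \<Rightarrow> int list set" where
  "bernoulli_chains n =
     {S. length S = Suc n \<and> S ! 0 = 0 \<and> (\<forall>i<n. S ! Suc i - S ! i \<in> {-1, 1})}"

text \<open>The argument is the number of steps, so that the set of Dyck paths with \<open>2n\<close> steps
  is \<open>dyck_paths (2 * n)\<close>.\<close>

definition dyck_paths :: "nat \<Rightarrow> int list set" where
  "dyck_paths m = {S \<in> bernoulli_chains m. S ! m = 0 \<and> (\<forall>i\<le>m. 0 \<le> S ! i)}"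

definition path_max :: "int list \<Rightarrow> int" where
  "path_max S = Max (set S)"

definition dyck_expectation :: "nat \<Rightarrow> (int list \<Rightarrow> real) \<Rightarrow> real" where
  "dyck_expectation m f = measure_pmf.expectation (pmf_of_set (dyck_paths m)) f"

text \<open>The uniform distribution \<^const>\<open>pmf_of_set\<close> is only meaningful on finite nonempty sets.\<close>

lemma finite_bernoulli_chains: "finite (bernoulli_chains n)"
proof -
  have bound: "\<bar>S ! i\<bar> \<le> int i" if S: "S \<in> bernoulli_chains n" and "i \<le> n" for S i
    using \<open>i \<le> n\<close>
  proof (induction i)
    case 0
    then show ?case using S by (simp add: bernoulli_chains_def)
  next
    case (Suc i)
    moreover have "S ! Suc i - S ! i \<in> {-1, 1}"
      using S Suc.prems by (simp add: bernoulli_chains_def)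
    ultimately show ?case by auto
  qed
  have "bernoulli_chains n \<subseteq> {S. set S \<subseteq> {- int n..int n} \<and> length S = Suc n}"
  proof
    fix S assume S: "S \<in> bernoulli_chains n"
    then have len: "length S = Suc n" by (simp add: bernoulli_chains_def)
    have "set S \<subseteq> {- int n..int n}"
    proof
      fix x assume "x \<in> set S"
      then obtain i where i: "i \<le> n" "x = S ! i"
        using len by (auto simp: in_set_conv_nth less_Suc_eq_le)
      then show "x \<in> {- int n..int n}" using bound[OF S i(1)] by auto
    qed
    then show "S \<in> {S. set S \<subseteq> {- int n..int n} \<and> length S = Suc n}" using len by simp
  qed
  then show ?thesis
    by (rule finite_subset) (rule finite_lists_length_eq, simp)
qed

lemma finite_dyck_paths: "finite (dyck_paths m)"
  by (rule finite_subset[OF _ finite_bernoulli_chains[of m]]) (auto simp: dyck_paths_def)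

lemma dyck_paths_nonempty: "dyck_paths (2 * n) \<noteq> {}"
proof -
  let ?S = "map (\<lambda>i. if even i then 0 else 1 :: int) [0..<Suc (2 * n)]"
  have nth: "?S ! i = (if even i then 0 else 1)" if "i \<le> 2 * n" for i
    using that by (subst nth_map) (auto simp del: upt_Suc)
  have "?S \<in> dyck_paths (2 * n)"
    unfolding dyck_paths_def bernoulli_chains_def
    using nth by (auto simp del: upt_Suc)
  then show ?thesis by blast
qed


section \<open>The normalized Brownian excursion\<close>

text \<open>Transition density at time \<open>s\<close>, from \<open>x > 0\<close> to \<open>y > 0\<close>, of Brownian motion killed when
  it hits \<open>0\<close> (reflection principle).\<close>

definition killed_density :: "real \<Rightarrow> real \<Rightarrow> real \<Rightarrow> real" where
  "killed_density s x y = normal_density 0 (sqrt s) (y - x) - normal_density 0 (sqrt s) (y + x)"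

text \<open>The limit of \<open>killed_density s x y / x\<close> as \<open>x\<close> decreases to \<open>0\<close>.\<close>

definition entrance_density :: "real \<Rightarrow> real \<Rightarrow> real" where
  "entrance_density s y = 2 * y / s * normal_density 0 (sqrt s) y"

text \<open>
  Joint density at \<open>(x\<^sub>0, \<dots>, x\<^sub>k)\<close>, for times \<open>0 < t\<^sub>0 < \<dots> < t\<^sub>k < 1\<close>, of Brownian motion
  conditioned to return to \<open>0\<close> at time \<open>1\<close> and to stay positive in between.  Conditioning Brownian
  motion started at \<open>a > 0\<close> to be at \<open>b > 0\<close> at time \<open>1\<close> without hitting \<open>0\<close> gives the density
  \[ \frac{p_{t_0}(a,x_0)\, \prod_{i<k} p_{t_{i+1}-t_i}(x_i,x_{i+1})\, p_{1-t_k}(x_k,b)}{p_1(a,b)} \]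
  where \<open>p\<close> is \<^const>\<open>killed_density\<close>.  The density below is its limit as \<open>a\<close> and \<open>b\<close>
  decrease to \<open>0\<close>, as shown by the lemma \<open>excursion_density_limit\<close>.  As \<open>p\<^sub>s(x, y) y / x\<close>
  is the transition density of the three-dimensional Bessel process, this is also the joint density
  of the three-dimensional Bessel bridge from \<open>0\<close> to \<open>0\<close> of duration \<open>1\<close>.
\<close>

definition excursion_density :: "nat \<Rightarrow> (nat \<Rightarrow> real) \<Rightarrow> (nat \<Rightarrow> real) \<Rightarrow> real" where
  "excursion_density k t x =
     (if \<forall>i\<le>k. 0 < x i
      then sqrt (pi / 2) * entrance_density (t 0) (x 0)
           * (\<Prod>i<k. killed_density (t (Suc i) - t i) (x i) (x (Suc i)))
           * entrance_density (1 - t k) (x k)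
      else 0)"

lemma killed_density_commute: "killed_density s x y = killed_density s y x"
  by (simp add: killed_density_def normal_density_def power2_commute add.commute)

lemma entrance_density_limit:
  assumes "s > 0"
  shows "((\<lambda>x. killed_density s x y / x) \<longlongrightarrow> entrance_density s y) (at_right 0)"
proof -
  have "((\<lambda>x. killed_density s x y) has_real_derivative entrance_density s y) (at 0)"
    using assms unfolding killed_density_def entrance_density_def normal_density_def
    by (auto intro!: derivative_eq_intros simp: field_simps)
  then have "((\<lambda>x. killed_density s x y / x) \<longlongrightarrow> entrance_density s y) (at 0)"
    by (simp add: has_field_derivative_iff killed_density_def)
  then show ?thesis by (rule tendsto_within_subset) simp
qed

lemma killed_density_1_limit:
  "((\<lambda>(a, b). killed_density 1 a b / (a * b)) \<longlongrightarrow> 1 / sqrt (pi / 2))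
     (at_right 0 \<times>\<^sub>F at_right 0)"
proof -
  let ?F = "at_right (0::real) \<times>\<^sub>F at_right (0::real)"
  let ?h = "\<lambda>p. exp (- ((fst p)\<^sup>2 + (snd p)\<^sup>2) / 2) / sqrt (2 * pi)
                * ((exp (fst p * snd p) - exp (- (fst p * snd p))) / (fst p * snd p))"
  have t: "filterlim fst (at_right 0) ?F" "filterlim snd (at_right 0) ?F"
    by (rule filterlim_fst filterlim_snd)+
  then have t0: "(fst \<longlongrightarrow> 0) ?F" "(snd \<longlongrightarrow> 0) ?F"
    by (auto intro: filterlim_mono[OF _ _ order_refl] simp: at_within_le_nhds)
  have pos: "eventually (\<lambda>p. 0 < fst p \<and> 0 < snd p) ?F"
    using t by (auto simp: filterlim_at eventually_conj_iff)
  have "filterlim (\<lambda>p. fst p * snd p) (at_right 0) ?F"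
    unfolding filterlim_at
  proof
    show "eventually (\<lambda>p. fst p * snd p \<in> {0<..} \<and> fst p * snd p \<noteq> 0) ?F"
      using pos by eventually_elim auto
    show "((\<lambda>p. fst p * snd p) \<longlongrightarrow> 0) ?F"
      using tendsto_mult[OF t0] by simp
  qed
  moreover have "((\<lambda>u::real. (exp u - exp (- u)) / u) \<longlongrightarrow> 2) (at_right 0)"
    by real_asymp
  ultimately have
    "((\<lambda>p. (exp (fst p * snd p) - exp (- (fst p * snd p))) / (fst p * snd p)) \<longlongrightarrow> 2) ?F"
    by (rule filterlim_compose[rotated])
  then have "(?h \<longlongrightarrow> exp (- (0\<^sup>2 + 0\<^sup>2) / 2) / sqrt (2 * pi) * 2) ?F"
    by (intro tendsto_intros t0) auto
  also have "exp (- (0\<^sup>2 + 0\<^sup>2) / 2) / sqrt (2 * pi) * 2 = 1 / sqrt (pi / 2)"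
    by (simp add: real_sqrt_mult real_sqrt_divide field_simps)
  finally show ?thesis
  proof (rule Lim_transform_eventually)
    have "?h p = (case p of (a, b) \<Rightarrow> killed_density 1 a b / (a * b))" for p
    proof (cases p)
      case (Pair a b)
      have "exp (- ((b - a)\<^sup>2) / 2) = exp (- (a\<^sup>2 + b\<^sup>2) / 2) * exp (a * b)"
           "exp (- ((b + a)\<^sup>2) / 2) = exp (- (a\<^sup>2 + b\<^sup>2) / 2) * exp (- (a * b))"
        by (simp_all flip: exp_add add: power2_eq_square field_simps)
      then show ?thesis
        by (simp add: Pair killed_density_def normal_density_def field_simps)
    qed
    then show "eventually (\<lambda>p. ?h p = (case p of (a, b) \<Rightarrow> killed_density 1 a b / (a * b))) ?F"
      by simp
  qed
qed

lemma excursion_density_limit: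
  assumes "0 < t 0" "t k < 1" and pos: "\<And>i. i \<le> k \<Longrightarrow> 0 < x i"
  shows "((\<lambda>(a, b). killed_density (t 0) a (x 0)
                     * (\<Prod>i<k. killed_density (t (Suc i) - t i) (x i) (x (Suc i)))
                     * killed_density (1 - t k) (x k) b / killed_density 1 a b)
           \<longlongrightarrow> excursion_density k t x) (at_right 0 \<times>\<^sub>F at_right 0)"
proof -
  let ?F = "at_right (0::real) \<times>\<^sub>F at_right (0::real)"
  let ?P = "\<Prod>i<k. killed_density (t (Suc i) - t i) (x i) (x (Suc i))"
  let ?h = "\<lambda>p. (killed_density (t 0) (fst p) (x 0) / fst p) * ?P
                * (killed_density (1 - t k) (snd p) (x k) / snd p)
                / (case p of (a, b) \<Rightarrow> killed_density 1 a b / (a * b))"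
  have t: "filterlim fst (at_right 0) ?F" "filterlim snd (at_right 0) ?F"
    by (rule filterlim_fst filterlim_snd)+
  have evpos: "eventually (\<lambda>p. 0 < fst p \<and> 0 < snd p) ?F"
    using t by (auto simp: filterlim_at eventually_conj_iff)
  have "((\<lambda>p. killed_density (t 0) (fst p) (x 0) / fst p) \<longlongrightarrow> entrance_density (t 0) (x 0)) ?F"
    by (rule filterlim_compose[OF entrance_density_limit t(1)]) fact
  moreover have "((\<lambda>p. killed_density (1 - t k) (snd p) (x k) / snd p)
                   \<longlongrightarrow> entrance_density (1 - t k) (x k)) ?F"
    by (rule filterlim_compose[OF entrance_density_limit t(2)]) (use assms in simp)
  ultimately have "(?h \<longlongrightarrow> entrance_density (t 0) (x 0) * ?P * entrance_density (1 - t k) (x k)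
                          / (1 / sqrt (pi / 2))) ?F"
    by (intro tendsto_intros killed_density_1_limit) auto
  also have "entrance_density (t 0) (x 0) * ?P * entrance_density (1 - t k) (x k)
               / (1 / sqrt (pi / 2)) = excursion_density k t x"
    using pos by (simp add: excursion_density_def)
  finally show ?thesis
  proof (rule Lim_transform_eventually)
    show "eventually (\<lambda>p. ?h p = (case p of (a, b) \<Rightarrow> killed_density (t 0) a (x 0) * ?P
            * killed_density (1 - t k) (x k) b / killed_density 1 a b)) ?F"
      using evpos
      by eventually_elim
        (auto simp: case_prod_beta killed_density_commute[of "1 - t k" "x k"] field_simps)
  qed
qed

text \<open>
  A normalized Brownian excursion on a probability space \<open>M\<close>: a process with continuous paths,
  vanishing at \<open>0\<close> and \<open>1\<close> and positive in between, whose finite-dimensional distributions are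
  those of Brownian motion conditioned to return to \<open>0\<close> at time \<open>1\<close> and to stay positive.  All
  paths are required to be continuous, so that the supremum over \<open>{0..1}\<close> is an attained maximum
  and is measurable even if \<open>M\<close> is not complete.
\<close>

definition normalized_brownian_excursion :: "'a measure \<Rightarrow> (real \<Rightarrow> 'a \<Rightarrow> real) \<Rightarrow> bool" where
  "normalized_brownian_excursion M e \<longleftrightarrow>
     prob_space M \<and>
     (\<forall>t\<in>{0..1}. e t \<in> borel_measurable M) \<and>
     (\<forall>\<omega>\<in>space M. continuous_on {0..1} (\<lambda>t. e t \<omega>)) \<and>
     (AE \<omega> in M. e 0 \<omega> = 0 \<and> e 1 \<omega> = 0 \<and> (\<forall>t\<in>{0<..<1}. 0 < e t \<omega>)) \<and>
     (\<forall>k t. 0 < t 0 \<and> (\<forall>i<k. t i < t (Suc i)) \<and> t k < 1 \<longrightarrow>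
        distributed M (\<Pi>\<^sub>M i\<in>{..k}. lborel) (\<lambda>\<omega>. \<lambda>i\<in>{..k}. e (t i) \<omega>)
          (\<lambda>x. ennreal (excursion_density k t x)))"

end

theory Submission
  imports Defs
begin

text \<open>
  Counts of walks with constraints satisfy a simple recursion, and the reflection principle gives
  them explicitly for nonnegative walks.  A local limit theorem for binomial coefficients turns the
  finite-dimensional laws of the rescaled Dyck path into densities converging pointwise to those of
  the excursion, and Fatou's lemma, applied to an event and to its complement, yields the
  convergence of the probabilities of events depending on the values on a finite grid.

  The only tightness needed is the following.  A nonnegative bridge of length at most \<open>L\<close> between
  points of \<open>{0..K}\<close> reaches \<open>H > K\<close> with conditional probability at most
  \<open>\<eta> = exp (- (H - K)\<^sup>2 / L) / (1 - exp (- (K + 1)\<^sup>2 / L))\<close>, by decomposing it at its first and last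
  visits of \<open>K\<close>.  With \<open>L = 2n\<close> this bounds the tail of the maximum by a Gaussian, uniformly in \<open>n\<close>;
  applied to each of \<open>m\<close> blocks of length about \<open>2n / m\<close>, it bounds from below the probability that
  the maximum is below \<open>H\<close> by \<open>(1 - \<eta>)\<^sup>m\<close> times the probability that all grid values are at most \<open>K\<close>,
  where \<open>m \<eta> \<longlonglongrightarrow> 0\<close> as \<open>m \<longlonglongrightarrow> \<infinity>\<close>.  Hence the law of the maximum converges at continuity points, and
  \<open>E (exp (c X)) = 1 + \<integral>\<^sub>0\<^sup>\<infinity> c exp (c x) P (X > x) dx\<close> with dominated convergence concludes.
\<close>

section \<open>Counting constrained walks\<close>

text \<open>The total weight of the \<open>i\<close>-step walks that end at \<open>b\<close>:
  \<open>v\<close> weights the starting point and \<open>Z j\<close> is the set allowed at time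
  \<open>j\<close>. Time 0 is left to \<open>v\<close>, so that a walk can be restarted at any time
  with its current weights as initial ones, as in \<open>walks_add\<close>.\<close>

primrec walks :: "(nat \<Rightarrow> int set) \<Rightarrow> (int \<Rightarrow> real) \<Rightarrow> nat \<Rightarrow> int \<Rightarrow> real" where
  "walks Z v 0 b = v b"
| "walks Z v (Suc i) b =
     (if b \<in> Z (Suc i) then walks Z v i (b - 1) + walks Z v i (b + 1) else 0)"

lemma walks_add: "walks Z v (i + j) b = walks (\<lambda>k. Z (i + k)) (walks Z v i) j b"
  by (induction j arbitrary: b) auto

lemma walks_nonneg: "(\<And>b. 0 \<le> v b) \<Longrightarrow> 0 \<le> walks Z v i b"
  by (induction i arbitrary: b) auto

lemma walks_mono:
  assumes "\<And>j. 0 < j \<Longrightarrow> j \<le> i \<Longrightarrow> Z j \<subseteq> Z' j" "\<And>b. v b \<le> v' b" "\<And>b. 0 \<le> v' b"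
  shows "walks Z v i b \<le> walks Z' v' i b"
  using assms(1)
proof (induction i arbitrary: b)
  case (Suc i)
  have "walks Z v i c \<le> walks Z' v' i c" for c
    by (rule Suc.IH) (use Suc.prems in auto)
  moreover have "0 \<le> walks Z' v' i c" for c
    using assms(3) by (rule walks_nonneg)
  moreover have "Z (Suc i) \<subseteq> Z' (Suc i)" using Suc.prems by auto
  ultimately show ?case by (auto simp: add_mono)
qed (use assms in auto)

lemma walks_cong:
  assumes "\<And>j. 0 < j \<Longrightarrow> j \<le> i \<Longrightarrow> Z j = Z' j"
  shows "walks Z v i b = walks Z' v i b"
  using assms by (induction i arbitrary: b) auto

lemma walks_scale: "walks Z (\<lambda>b. r * v b) i b = r * walks Z v i b"
  by (induction i arbitrary: b) (auto simp: algebra_simps)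

lemma card_chains:
  "real (card {S \<in> bernoulli_chains m. (\<forall>j\<le>m. S ! j \<in> Z j) \<and> S ! m = b}) =
     walks Z (\<lambda>b. of_bool (b = 0 \<and> 0 \<in> Z 0)) m b"
proof (induction m arbitrary: b)
  case 0
  have "{S \<in> bernoulli_chains 0. (\<forall>j\<le>0. S ! j \<in> Z j) \<and> S ! 0 = b} =
        (if b = 0 \<and> 0 \<in> Z 0 then {[0]} else {})"
    by (auto simp: bernoulli_chains_def length_Suc_conv)
  then show ?case by simp
next
  case (Suc m)
  define A where "A m b = {S \<in> bernoulli_chains m. (\<forall>j\<le>m. S ! j \<in> Z j) \<and> S ! m = b}" for m b
  have fin: "finite (A m c)" for c
    unfolding A_def using finite_bernoulli_chains[of m] by auto
  \<comment> \<open>Removing the last value maps these chains bijectively to the chains with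
    \<open>m\<close> steps that end at a neighbour of \<open>b\<close>, which is the recursion of
    \<open>walks\<close>.\<close>
  have "A (Suc m) b = (if b \<in> Z (Suc m) then (\<lambda>S. S @ [b]) ` (A m (b - 1) \<union> A m (b + 1)) else {})"
  proof (intro equalityI subsetI)
    fix S assume S: "S \<in> A (Suc m) b"
    then have len: "length S = Suc (Suc m)" and nth: "S ! Suc m = b"
      and diff: "S ! Suc m - S ! m \<in> {-1, 1}" and b: "b \<in> Z (Suc m)"
      by (auto simp: A_def bernoulli_chains_def)
    have eq: "S = butlast S @ [b]"
      using len nth by (metis append_butlast_last_id diff_Suc_1 last_conv_nth length_0_conv nat.distinct(1))
    have nb: "butlast S ! i = S ! i" if "i \<le> m" for i
      using that len by (simp add: nth_butlast)
    have "butlast S \<in> A m (S ! m)"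
      using S len nb by (auto simp: A_def bernoulli_chains_def)
    moreover have "S ! m = b - 1 \<or> S ! m = b + 1" using diff nth by auto
    ultimately show "S \<in> (if b \<in> Z (Suc m) then (\<lambda>S. S @ [b]) ` (A m (b - 1) \<union> A m (b + 1)) else {})"
      using eq b by (metis (no_types, lifting) UnI1 UnI2 image_eqI)
  next
    fix S assume "S \<in> (if b \<in> Z (Suc m) then (\<lambda>S. S @ [b]) ` (A m (b - 1) \<union> A m (b + 1)) else {})"
    then obtain T where T: "S = T @ [b]" "T \<in> A m (b - 1) \<union> A m (b + 1)" and b: "b \<in> Z (Suc m)"
      by (auto split: if_splits)
    then have len: "length T = Suc m" by (auto simp: A_def bernoulli_chains_def)
    show "S \<in> A (Suc m) b"
      using T b len by (auto simp: A_def bernoulli_chains_def nth_append less_Suc_eq le_Suc_eq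
        dest: Suc_lessD)
  qed
  moreover have "A m (b - 1) \<inter> A m (b + 1) = {}" by (auto simp: A_def)
  moreover have "inj_on (\<lambda>S. S @ [b]) X" for X by (auto simp: inj_on_def)
  ultimately have "card (A (Suc m) b) = (if b \<in> Z (Suc m) then card (A m (b - 1)) + card (A m (b + 1)) else 0)"
    using fin by (simp add: card_image card_Un_disjoint)
  then show ?case
    using Suc.IH by (simp add: A_def)
qed

text \<open>The number of \<open>i\<close>-step walks from \<open>a\<close> to \<open>b\<close> with
  all values in \<open>X\<close>. The initial weight tests \<open>a\<close> itself, which
  \<open>walks\<close> does not do.\<close>

definition ker :: "int set \<Rightarrow> int \<Rightarrow> nat \<Rightarrow> int \<Rightarrow> real" where
  "ker X a i b = walks (\<lambda>_. X) (\<lambda>b. of_bool (b = a \<and> a \<in> X)) i b"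

lemma ker_0 [simp]: "ker X a 0 b = of_bool (b = a \<and> a \<in> X)"
  and ker_Suc: "ker X a (Suc i) b = (if b \<in> X then ker X a i (b - 1) + ker X a i (b + 1) else 0)"
  by (simp_all add: ker_def)

lemma ker_nonneg: "0 \<le> ker X a i b"
  unfolding ker_def by (rule walks_nonneg) simp

lemma ker_outside: "b \<notin> X \<Longrightarrow> ker X a i b = 0"
  by (cases i) (auto simp: ker_Suc)

text \<open>Decomposition at the first step, where \<open>ker_Suc\<close> uses the last one; the two
  together give the symmetry \<open>ker_commute\<close> without reversing paths.\<close>

lemma ker_Suc_left: "ker X a (Suc i) b = (if a \<in> X then ker X (a - 1) i b + ker X (a + 1) i b else 0)"
  by (induction i arbitrary: b) (auto simp: ker_Suc)

lemma ker_commute: "ker X a i b = ker X b i a"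
proof (induction i arbitrary: a b)
  case (Suc i)
  show ?case unfolding ker_Suc[of X a] ker_Suc_left[of X b] by (simp add: Suc.IH)
qed auto

lemma walks_superposition:
  assumes "finite A" "A \<subseteq> X" "\<And>b. b \<notin> A \<Longrightarrow> v b = 0"
  shows "walks (\<lambda>_. X) v i b = (\<Sum>a\<in>A. v a * ker X a i b)"
proof (induction i arbitrary: b)
  case 0
  have "(\<Sum>a\<in>A. v a * ker X a 0 b) = (\<Sum>a\<in>A. if a = b then v a else 0)"
    using assms(2) by (intro sum.cong) auto
  then show ?case using assms by auto
next
  case (Suc i)
  then show ?case by (simp add: ker_Suc sum.distrib algebra_simps)
qed

text \<open>For \<open>b\<close> from 0 to \<open>K - 1\<close> the two kernels obey the same
  recursion, and both neighbours of \<open>b\<close> are at most \<open>K\<close>; so the inequality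
  assumed at \<open>K\<close> propagates downwards by induction on \<open>i\<close>. In terms of
  paths this is the decomposition at the last visit of \<open>K\<close>; walks that never visit
  \<open>K\<close> only need \<open>q \<le> 1\<close>.\<close>

lemma ker_transfer_last:
  assumes K: "K \<in> {0..<H}" and q: "q \<le> 1" and a: "a \<in> {0..K}"
    and base: "\<And>i. i \<le> L \<Longrightarrow> q * ker {0..} a i K \<le> ker {0..<H} a i K"
  shows "i \<le> L \<Longrightarrow> b \<le> K \<Longrightarrow> q * ker {0..} a i b \<le> ker {0..<H} a i b"
proof (induction i arbitrary: b)
  case 0
  then show ?case using q K a by auto
next
  case (Suc i)
  show ?case
  proof (cases "b = K \<or> b < 0")
    case True
    then show ?thesis using base[OF Suc.prems(1)] by (auto simp: ker_outside)
  next
    case False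
    then have b: "b \<in> {0..}" "b \<in> {0..<H}" and le: "b - 1 \<le> K" "b + 1 \<le> K"
      using K Suc.prems by auto
    have "q * ker {0..} a i (b - 1) \<le> ker {0..<H} a i (b - 1)"
         "q * ker {0..} a i (b + 1) \<le> ker {0..<H} a i (b + 1)"
      using Suc le by auto
    then show ?thesis using b by (simp add: ker_Suc distrib_left)
  qed
qed

text \<open>A walk from \<open>a\<close> to \<open>b\<close> that exceeds \<open>K\<close> contains, between its first and its last visit of
  \<open>K\<close>, a walk from \<open>K\<close> to \<open>K\<close>; the other pieces stay below \<open>K\<close>.\<close>

lemma ker_transfer:
  assumes K: "K \<in> {0..<H}" and q: "q \<le> 1"
    and base: "\<And>i. i \<le> L \<Longrightarrow> q * ker {0..} K i K \<le> ker {0..<H} K i K"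
    and "i \<le> L" "a \<in> {0..K}" "b \<in> {0..K}"
  shows "q * ker {0..} a i b \<le> ker {0..<H} a i b"
proof -
  \<comment> \<open>Walks from \<open>K\<close> to \<open>a\<close>; by symmetry this is the
    boundary condition at \<open>K\<close> for walks that start at \<open>a\<close>.\<close>
  have "q * ker {0..} K i a \<le> ker {0..<H} K i a" if "i \<le> L" for i
    by (rule ker_transfer_last[OF K q _ base]) (use K assms that in auto)
  then have *: "q * ker {0..} a i K \<le> ker {0..<H} a i K" if "i \<le> L" for i
    using that by (simp add: ker_commute[of _ a])
  show ?thesis
    by (rule ker_transfer_last[OF K q _ *]) (use assms in auto)
qed

section \<open>Free walks and the reflection principle\<close>

abbreviation srw :: "nat \<Rightarrow> int \<Rightarrow> real" where
  "srw \<equiv> ker UNIV 0"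

lemma srw_minus: "srw i (- k) = srw i k"
proof (induction i arbitrary: k)
  case (Suc i)
  have "srw i (- k - 1) = srw i (k + 1)" "srw i (- k + 1) = srw i (k - 1)"
    using Suc[of "k + 1"] Suc[of "k - 1"] by simp_all
  then show ?case by (simp add: ker_Suc)
qed auto

lemma srw_odd: "odd (int i + k) \<Longrightarrow> srw i k = 0"
  by (induction i arbitrary: k) (auto simp: ker_Suc)

lemma srw_beyond: "k < - int i \<Longrightarrow> srw i k = 0"
  by (induction i arbitrary: k) (auto simp: ker_Suc)

text \<open>A walk with \<open>j\<close> up-steps out of \<open>i\<close> ends at
  \<open>2 * j - i\<close>; the recursion is Pascal's rule.\<close>

lemma srw_binomial: "srw i (2 * int j - int i) = real (i choose j)"
proof (induction i arbitrary: j)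
  case 0
  then show ?case by (cases j) auto
next
  case (Suc i)
  show ?case
  proof (cases j)
    case 0
    then show ?thesis using Suc[of 0] by (simp add: ker_Suc srw_beyond)
  next
    case j: (Suc j')
    have "2 * int j - int (Suc i) - 1 = 2 * int j' - int i"
         "2 * int j - int (Suc i) + 1 = 2 * int j - int i" using j by auto
    then have "srw (Suc i) (2 * int j - int (Suc i)) = real (i choose j') + real (i choose j)"
      using Suc[of j'] Suc[of j] by (simp only: ker_Suc) simp
    then show ?thesis using j by simp
  qed
qed

lemma srw_even_binomial: "srw (2 * i) (2 * int k) = real ((2 * i) choose (i + k))"
  using srw_binomial[of "2 * i" "i + k"] by (simp add: algebra_simps)

text \<open>Reflection at -1: the right-hand side satisfies the free recursion, has the right
  initial values, and vanishes at \<open>b = - 1\<close> by \<open>srw_minus\<close>. Including this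
  boundary point in the range makes the induction close.\<close>

lemma ker_nonneg_reflection:
  assumes "0 \<le> a" "- 1 \<le> b"
  shows "ker {0..} a i b = srw i (b - a) - srw i (b + a + 2)"
  using assms(2)
proof (induction i arbitrary: b)
  case 0
  then show ?case using assms(1) by auto
next
  case (Suc i)
  show ?case
  proof (cases "b = - 1")
    case True
    then show ?thesis using srw_minus[of "Suc i" "1 + a"] by (simp add: ker_outside add.commute)
  next
    case False
    then have "0 \<le> b" using Suc.prems by auto
    then show ?thesis using Suc.IH[of "b - 1"] Suc.IH[of "b + 1"]
      by (simp add: ker_Suc algebra_simps)
  qed
qed

text \<open>Bonferroni's inequality: walks that reach -1 and walks that reach \<open>H\<close> are
  each counted by one reflection and both subtracted. The left-hand side solves the free recursion
  and is at most 0 at the boundary points -1 and \<open>H\<close>, so induction keeps it below the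
  kernel.\<close>

lemma ker_strip_lower_bound:
  assumes "a \<in> {0..<H}" "b \<in> {- 1..H}"
  shows "srw i (b - a) - srw i (b + a + 2) - srw i (2 * H - a - b) \<le> ker {0..<H} a i b"
  using assms(2)
proof (induction i arbitrary: b)
  case 0
  then show ?case using assms(1) by auto
next
  case (Suc i)
  consider "b = - 1" | "b = H" | "b \<in> {0..<H}" using Suc.prems by fastforce
  then show ?case
  proof cases
    case 1
    then show ?thesis using srw_minus[of "Suc i" "1 + a"] ker_nonneg[of UNIV 0 "Suc i"]
      by (simp add: ker_outside add.commute)
  next
    case 2
    then show ?thesis using ker_nonneg[of UNIV 0 "Suc i"]
      by (simp add: ker_outside)
  next
    case 3
    then show ?thesis using Suc.IH[of "b - 1"] Suc.IH[of "b + 1"]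
      by (simp add: ker_Suc[of _ _ _ b] ker_Suc[of UNIV] algebra_simps)
  qed
qed

section \<open>Gaussian bounds for binomial coefficients near the centre\<close>

lemma central_binomial_step:
  assumes "i \<le> l"
  shows "real (Suc (l + i)) * real ((2 * l) choose Suc (l + i)) =
         (real l - real i) * real ((2 * l) choose (l + i))"
proof -
  have "Suc (l + i) * ((2 * l) choose Suc (l + i)) = (2 * l - (l + i)) * ((2 * l) choose (l + i))"
    using binomial_absorb_comp[of "2 * l" "l + i"] binomial_absorption[of "l + i" "2 * l"] by simp
  also have "2 * l - (l + i) = l - i" by simp
  finally have "real (Suc (l + i) * ((2 * l) choose Suc (l + i))) = real ((l - i) * ((2 * l) choose (l + i)))"
    by (simp only:)
  then show ?thesis using assms by (simp only: of_nat_mult of_nat_diff)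
qed

text \<open>The quotient of consecutive coefficients is
  \<open>1 - (2 * i + 1) / (l + i + 1)\<close>, at most \<open>exp (- (2 * i + 1) / (l + k))\<close>
  for \<open>i < k\<close>, and the odd numbers add up to a square. The cap \<open>k\<close> gives
  all factors a common denominator.\<close>

lemma central_binomial_quotient_upper:
  assumes "i \<le> k" "k \<le> l" "0 < l"
  shows "real ((2 * l) choose (l + i)) \<le> real ((2 * l) choose l) * exp (- (real i)\<^sup>2 / real (l + k))"
  using assms(1)
proof (induction i)
  case (Suc i)
  have "real (Suc (l + i)) * real ((2 * l) choose Suc (l + i)) =
        (real l - real i) * real ((2 * l) choose (l + i))"
    using Suc.prems assms by (intro central_binomial_step) simp
  then have "real ((2 * l) choose Suc (l + i)) = (1 - (2 * real i + 1) / real (Suc (l + i))) * real ((2 * l) choose (l + i))"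
    by (simp add: field_simps)
  also have "\<dots> \<le> exp (- (2 * real i + 1) / real (l + k)) * real ((2 * l) choose (l + i))"
  proof (rule mult_right_mono)
    have "1 - (2 * real i + 1) / real (Suc (l + i)) \<le> 1 - (2 * real i + 1) / real (l + k)"
      using Suc.prems assms by (intro diff_left_mono divide_left_mono) auto
    also have "\<dots> = 1 + (- (2 * real i + 1) / real (l + k))"
      by (simp only: minus_divide_left diff_conv_add_uminus)
    also have "\<dots> \<le> exp (- (2 * real i + 1) / real (l + k))"
      using exp_ge_add_one_self[of "- (2 * real i + 1) / real (l + k)"] .
    finally show "1 - (2 * real i + 1) / real (Suc (l + i)) \<le> exp (- (2 * real i + 1) / real (l + k))" .
  qed simp
  also have "\<dots> \<le> exp (- (2 * real i + 1) / real (l + k)) * (real ((2 * l) choose l) * exp (- (real i)\<^sup>2 / real (l + k)))"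
    using Suc by (intro mult_left_mono) auto
  also have "\<dots> = real ((2 * l) choose l) * exp (- (real (Suc i))\<^sup>2 / real (l + k))"
    by (simp add: power2_eq_square algebra_simps flip: exp_add add_divide_distrib diff_divide_distrib)
  finally show ?case by simp
qed simp

text \<open>The inverse quotients are \<open>1 + (2 * i + 1) / (l - i)\<close>, and
  \<open>l - k\<close> bounds all their denominators from below.\<close>

lemma central_binomial_quotient_lower:
  assumes "i \<le> k" "k < l"
  shows "real ((2 * l) choose l) * exp (- (real i)\<^sup>2 / real (l - k)) \<le> real ((2 * l) choose (l + i))"
  using assms(1)
proof (induction i)
  case (Suc i)
  have "real (Suc (l + i)) * real ((2 * l) choose Suc (l + i)) =
        (real l - real i) * real ((2 * l) choose (l + i))"
    using Suc.prems assms by (intro central_binomial_step) simp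
  then have eq: "(1 + (2 * real i + 1) / (real l - real i)) * real ((2 * l) choose Suc (l + i)) = real ((2 * l) choose (l + i))"
    using Suc.prems assms by (simp add: field_simps)
  have "1 + (2 * real i + 1) / (real l - real i) \<le> 1 + (2 * real i + 1) / real (l - k)"
    using Suc.prems assms by (intro add_left_mono divide_left_mono) auto
  also have "\<dots> \<le> exp ((2 * real i + 1) / real (l - k))"
    using exp_ge_add_one_self[of "(2 * real i + 1) / real (l - k)"] by simp
  finally have "real ((2 * l) choose (l + i)) \<le> exp ((2 * real i + 1) / real (l - k)) * real ((2 * l) choose Suc (l + i))"
    unfolding eq[symmetric] by (rule mult_right_mono) simp
  with Suc have "real ((2 * l) choose l) * exp (- (real i)\<^sup>2 / real (l - k)) \<le> exp ((2 * real i + 1) / real (l - k)) * real ((2 * l) choose Suc (l + i))"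
    by simp
  then have "exp (- (2 * real i + 1) / real (l - k)) * (real ((2 * l) choose l) * exp (- (real i)\<^sup>2 / real (l - k))) \<le> real ((2 * l) choose Suc (l + i))"
    by (subst (asm) mult_le_cancel_left_pos[symmetric, where c = "exp (- (2 * real i + 1) / real (l - k))"])
       (auto simp: mult.assoc[symmetric] simp flip: exp_add add_divide_distrib diff_divide_distrib)
  moreover have "exp (- (2 * real i + 1) / real (l - k)) * (real ((2 * l) choose l) * exp (- (real i)\<^sup>2 / real (l - k)))
    = real ((2 * l) choose l) * exp (- (real (Suc i))\<^sup>2 / real (l - k))"
    by (simp add: power2_eq_square algebra_simps flip: exp_add add_divide_distrib diff_divide_distrib)
  ultimately show ?case by (simp only: add_Suc_right)
qed simp

text \<open>For \<open>i = 2 * l\<close> and \<open>d \<le> l\<close> the quotient bound with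
  \<open>k = d\<close> has denominator \<open>l + d\<close>, at most \<open>i \<le> L\<close>. For
  odd \<open>i\<close> and for \<open>d > l\<close> the left-hand side is 0. The bound is thus
  uniform over all lengths up to \<open>L\<close>, as \<open>ker_transfer\<close> requires.\<close>

lemma srw_gaussian_bound:
  assumes "i \<le> L" "0 < L"
  shows "srw i (2 * int d) \<le> exp (- (real d)\<^sup>2 / real L) * srw i 0"
proof -
  consider "odd i" | l where "i = 2 * l" "l < d" | l where "i = 2 * l" "d \<le> l" "l = 0" | l where "i = 2 * l" "d \<le> l" "0 < l"
    by (metis evenE gr0I not_le)
  then show ?thesis
  proof cases
    case 4
    have "srw i (2 * int d) \<le> exp (- (real d)\<^sup>2 / real (l + d)) * srw i 0"
      using central_binomial_quotient_upper[OF order_refl 4(2,3)] srw_even_binomial[of l d] srw_even_binomial[of l 0]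
      by (simp add: 4(1) mult.commute)
    also have "\<dots> \<le> exp (- (real d)\<^sup>2 / real L) * srw i 0"
    proof (intro mult_right_mono ker_nonneg)
      have "(real d)\<^sup>2 / real L \<le> (real d)\<^sup>2 / real (l + d)"
        using 4 assms by (intro divide_left_mono) auto
      show "exp (- (real d)\<^sup>2 / real (l + d)) \<le> exp (- (real d)\<^sup>2 / real L)"
        using \<open>(real d)\<^sup>2 / real L \<le> (real d)\<^sup>2 / real (l + d)\<close> by simp
    qed
    finally show ?thesis .
  qed (auto simp: srw_odd srw_even_binomial ker_nonneg binomial_eq_0)
qed

text \<open>The right-hand side bounds the probability that a nonnegative bridge from \<open>K\<close> to \<open>K\<close>
  reaches \<open>H\<close>: reflection at \<open>H\<close> for the numerator, at \<open>- 1\<close> for the denominator.\<close>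

definition overshoot :: "nat \<Rightarrow> nat \<Rightarrow> nat \<Rightarrow> real" where
  "overshoot L K H = exp (- (real (H - K))\<^sup>2 / real L) / (1 - exp (- (real (Suc K))\<^sup>2 / real L))"

text \<open>By \<open>ker_transfer\<close> only walks from \<open>K\<close> to \<open>K\<close>
  matter. There \<open>ker_strip_lower_bound\<close> loses \<open>srw i (2 * int (H - K))\<close>
  against the walks on \<open>{0..}\<close>, and the latter number at least \<open>1 - ?E\<close>
  times \<open>srw i 0\<close>; \<open>srw_gaussian_bound\<close> compares everything with
  \<open>srw i 0\<close>.\<close>

lemma ker_overshoot:
  assumes KH: "K < H" and L: "0 < L" and i: "i \<le> L" and a: "a \<in> {0..int K}" and b: "b \<in> {0..int K}"
  shows "(1 - overshoot L K H) * ker {0..} a i b \<le> ker {0..<int H} a i b"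
proof (rule ker_transfer[where K = "int K" and L = L])
  have pos: "0 < 1 - exp (- (real (Suc K))\<^sup>2 / real L)" using L by simp
  show "1 - overshoot L K H \<le> 1" unfolding overshoot_def using pos by simp
  fix i assume i: "i \<le> L"
  let ?E = "exp (- (real (Suc K))\<^sup>2 / real L)" and ?F = "exp (- (real (H - K))\<^sup>2 / real L)"
  have 1: "ker {0..} (int K) i (int K) = srw i 0 - srw i (2 * int (Suc K))"
    by (subst ker_nonneg_reflection) (auto simp: algebra_simps)
  have "srw i (int K - int K) - srw i (int K + int K + 2) - srw i (2 * int H - int K - int K) \<le> ker {0..<int H} (int K) i (int K)"
    by (rule ker_strip_lower_bound) (use KH in auto)
  then have 2: "ker {0..} (int K) i (int K) - srw i (2 * int (H - K)) \<le> ker {0..<int H} (int K) i (int K)"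
    unfolding 1 using KH by (simp add: of_nat_diff algebra_simps)
  have "srw i (2 * int (H - K)) \<le> ?F * srw i 0"
    by (rule srw_gaussian_bound[OF i L])
  also have "\<dots> = overshoot L K H * ((1 - ?E) * srw i 0)"
    unfolding overshoot_def using pos L by simp
  also have "\<dots> \<le> overshoot L K H * ker {0..} (int K) i (int K)"
  proof (rule mult_left_mono)
    show "(1 - ?E) * srw i 0 \<le> ker {0..} (int K) i (int K)"
      unfolding 1 using srw_gaussian_bound[OF i L, of "Suc K"] by (simp add: algebra_simps)
    show "0 \<le> overshoot L K H" unfolding overshoot_def using pos by simp
  qed
  finally show "(1 - overshoot L K H) * ker {0..} (int K) i (int K) \<le> ker {0..<int H} (int K) i (int K)"
    using 2 by (simp add: algebra_simps)
qed (use assms in auto)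

section \<open>Dyck paths as constrained walks\<close>

lemma walks_outside:
  assumes "\<And>b. b \<notin> Z 0 \<Longrightarrow> v b = 0" "b \<notin> Z i"
  shows "walks Z v i b = 0"
  using assms by (cases i) auto

lemma walks_start: "0 \<in> X \<Longrightarrow> walks (\<lambda>_. X) (\<lambda>b. of_bool (b = 0)) = ker X 0"
  by (auto simp: ker_def fun_eq_iff)

definition dyck_pmf :: "nat \<Rightarrow> int list pmf" where
  "dyck_pmf n = pmf_of_set (dyck_paths (2 * n))"

abbreviation dyck_prob :: "nat \<Rightarrow> int list set \<Rightarrow> real" where
  "dyck_prob n \<equiv> measure_pmf.prob (dyck_pmf n)"

lemma set_dyck_pmf: "set_pmf (dyck_pmf n) = dyck_paths (2 * n)"
  unfolding dyck_pmf_def by (rule set_pmf_of_set[OF dyck_paths_nonempty finite_dyck_paths])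

lemma dyck_prob_walks:
  assumes "\<And>j. j \<le> 2 * n \<Longrightarrow> Z j \<subseteq> {0..}" "0 \<in> Z 0"
  shows "dyck_prob n {S. \<forall>j\<le>2*n. S ! j \<in> Z j} =
           walks Z (\<lambda>b. of_bool (b = 0)) (2 * n) 0 / ker {0..} 0 (2 * n) 0"
proof -
  have card: "real (card (dyck_paths (2 * n) \<inter> {S. \<forall>j\<le>2*n. S ! j \<in> Z j})) =
      walks Z (\<lambda>b. of_bool (b = 0)) (2 * n) 0"
    if "\<And>j. j \<le> 2 * n \<Longrightarrow> Z j \<subseteq> {0..}" "0 \<in> Z 0" for Z
  proof -
    have "dyck_paths (2 * n) \<inter> {S. \<forall>j\<le>2*n. S ! j \<in> Z j} =
        {S \<in> bernoulli_chains (2 * n). (\<forall>j\<le>2*n. S ! j \<in> Z j) \<and> S ! (2 * n) = 0}"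
      using that by (force simp: dyck_paths_def)
    then show ?thesis using card_chains[of "2 * n" Z 0] that by simp
  qed
  have "real (card (dyck_paths (2 * n))) = ker {0..} 0 (2 * n) 0"
    using card[of "\<lambda>_. {0..}"]
    by (simp add: walks_start dyck_paths_def Int_def conj_ac cong: conj_cong)
  then show ?thesis
    using card[of Z, OF assms] unfolding dyck_pmf_def
    by (simp add: measure_pmf_of_set dyck_paths_nonempty finite_dyck_paths)
qed

section \<open>Events of a uniform Dyck path and the law of its maximum\<close>

lemma dyck_pathD:
  assumes "S \<in> dyck_paths m"
  shows "length S = Suc m" "S ! 0 = 0" "S ! m = 0" "\<And>i. i \<le> m \<Longrightarrow> 0 \<le> S ! i"
  using assms by (auto simp: dyck_paths_def bernoulli_chains_def)

lemma path_max_less_iff: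
  assumes "S \<in> dyck_paths m"
  shows "path_max S < H \<longleftrightarrow> (\<forall>j\<le>m. S ! j < H)"
proof -
  have "S \<noteq> []" using dyck_pathD(1)[OF assms] by auto
  then show ?thesis
    unfolding path_max_def
    by (simp add: all_set_conv_all_nth dyck_pathD(1)[OF assms] less_Suc_eq_le)
qed

lemma path_max_nth: "S \<in> dyck_paths m \<Longrightarrow> j \<le> m \<Longrightarrow> S ! j \<le> path_max S"
  using path_max_less_iff[of S m "path_max S + 1"] by auto

lemma path_max_nonneg: "S \<in> dyck_paths m \<Longrightarrow> 0 \<le> path_max S"
  using path_max_nth[of S m 0] dyck_pathD(2)[of S m] by simp

lemma dyck_prob_cong:
  assumes "\<And>S. S \<in> dyck_paths (2 * n) \<Longrightarrow> S \<in> A \<longleftrightarrow> S \<in> B"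
  shows "dyck_prob n A = dyck_prob n B"
  by (rule measure_pmf.finite_measure_eq_AE) (auto simp: AE_measure_pmf_iff set_dyck_pmf assms)

lemma dyck_prob_mono:
  assumes "\<And>S. S \<in> dyck_paths (2 * n) \<Longrightarrow> S \<in> A \<Longrightarrow> S \<in> B"
  shows "dyck_prob n A \<le> dyck_prob n B"
  by (rule measure_pmf.finite_measure_mono_AE) (auto simp: AE_measure_pmf_iff set_dyck_pmf assms)

lemma dyck_prob_max_less:
  assumes "0 < H"
  shows "dyck_prob n {S. path_max S < H} = ker {0..<H} 0 (2 * n) 0 / ker {0..} 0 (2 * n) 0"
proof -
  have "dyck_prob n {S. path_max S < H} = dyck_prob n {S. \<forall>j\<le>2*n. S ! j \<in> {0..<H}}"
    by (rule dyck_prob_cong) (auto simp: path_max_less_iff dest: dyck_pathD(4))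
  also have "\<dots> = ker {0..<H} 0 (2 * n) 0 / ker {0..} 0 (2 * n) 0"
    using assms by (subst dyck_prob_walks) (auto simp: walks_start)
  finally show ?thesis .
qed

text \<open>The sure event has probability 1, and \<open>dyck_prob_walks\<close> writes this
  probability as the count divided by itself. A zero count would make the quotient 0, since
  \<open>x / 0 = 0\<close>.\<close>

lemma dyck_count_pos: "0 < ker {0..} 0 (2 * n) 0"
  using dyck_prob_walks[of n "\<lambda>_. {0..}"] dyck_prob_cong[of n "{S. \<forall>j\<le>2*n. S ! j \<in> {0..}}" UNIV]
    ker_nonneg[of "{0..}" 0 "2 * n" 0]
  by (auto simp: dyck_pathD(4) less_le walks_start)

lemma dyck_max_tail:
  assumes "K < H" "0 < n"
  shows "dyck_prob n {S. int H \<le> path_max S} \<le> overshoot (2 * n) K H"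
proof -
  have "(1 - overshoot (2 * n) K H) * ker {0..} 0 (2 * n) 0 \<le> ker {0..<int H} 0 (2 * n) 0"
    by (rule ker_overshoot) (use assms in auto)
  then have "1 - overshoot (2 * n) K H \<le> dyck_prob n {S. path_max S < int H}"
    using assms dyck_count_pos[of n] by (simp add: dyck_prob_max_less field_simps)
  moreover have "dyck_prob n {S. int H \<le> path_max S} = 1 - dyck_prob n {S. path_max S < int H}"
    by (subst measure_pmf.prob_compl[symmetric]) (auto intro!: arg_cong[where f = "dyck_prob n"])
  ultimately show ?thesis by simp
qed

text \<open>Induction over the blocks between consecutive times \<open>s j\<close>. The walk is at
  most \<open>K\<close> at these times, so each block starts and ends in \<open>{0..int K}\<close>,
  and \<open>ker_overshoot\<close> confines it to \<open>{0..<int H}\<close> at the price of one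
  factor \<open>1 - overshoot L K H\<close>. These factors must be nonnegative for the bounds to
  multiply, hence \<open>le\<close>.\<close>

lemma grid_walks:
  assumes s: "s 0 = 0" "\<And>j. j < m \<Longrightarrow> s j \<le> s (Suc j)" "\<And>j. j < m \<Longrightarrow> s (Suc j) - s j \<le> L"
    and KH: "K < H" and L: "0 < L" and le: "overshoot L K H \<le> 1"
    and Z: "Z = (\<lambda>r. {x. 0 \<le> x \<and> (\<forall>j\<le>m. s j = r \<longrightarrow> x \<le> int K)})"
  shows "j \<le> m \<Longrightarrow> (1 - overshoot L K H) ^ j * walks Z (\<lambda>b. of_bool (b = 0)) (s j) b
                   \<le> ker {0..<int H} 0 (s j) b"
proof (induction j arbitrary: b)
  case 0
  then show ?case using s KH by simp
next
  case (Suc j)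
  define q where "q = 1 - overshoot L K H"
  define l where "l = s (Suc j) - s j"
  define v where "v = walks Z (\<lambda>b. of_bool (b = 0)) (s j)"
  have q: "0 \<le> q" using le by (simp add: q_def)
  have sj: "s (Suc j) = s j + l" and l: "l \<le> L" using s Suc.prems by (auto simp: l_def)
  have supp: "walks Z (\<lambda>b. of_bool (b = 0)) (s i) c = 0" if "i \<le> m" "c \<notin> {0..int K}" for i c
    by (rule walks_outside) (use that in \<open>auto simp: Z\<close>)
  have v: "v c = 0" if "c \<notin> {0..int K}" for c
    unfolding v_def using supp Suc.prems that by auto
  have v0: "0 \<le> v c" for c unfolding v_def by (rule walks_nonneg) simp
  show ?case
  proof (cases "b \<in> {0..int K}")
    case False
    then show ?thesis using supp[OF Suc.prems False] ker_nonneg by simp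
  next
    case True
    have "walks Z (\<lambda>b. of_bool (b = 0)) (s (Suc j)) b = walks (\<lambda>k. Z (s j + k)) v l b"
      unfolding sj walks_add v_def ..
    \<comment> \<open>Inside the block only nonnegativity is kept; as \<open>v\<close> is supported
      in \<open>{0..int K}\<close>, the result is a finite mixture over starting points.\<close>
    also have "\<dots> \<le> walks (\<lambda>_. {0..}) v l b"
      by (rule walks_mono) (auto simp: Z v0)
    also have "\<dots> = (\<Sum>a\<in>{0..int K}. v a * ker {0..} a l b)"
      by (rule walks_superposition) (use v in auto)
    finally have "q ^ Suc j * walks Z (\<lambda>b. of_bool (b = 0)) (s (Suc j)) b \<le>
        q ^ Suc j * (\<Sum>a\<in>{0..int K}. v a * ker {0..} a l b)"
      using q by (intro mult_left_mono) auto
    also have "\<dots> = (\<Sum>a\<in>{0..int K}. (q ^ j * v a) * (q * ker {0..} a l b))"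
      by (simp add: sum_distrib_left mult_ac)
    also have "\<dots> \<le> (\<Sum>a\<in>{0..int K}. (q ^ j * v a) * ker {0..<int H} a l b)"
    proof (intro sum_mono mult_left_mono)
      fix a assume "a \<in> {0..int K}"
      then show "q * ker {0..} a l b \<le> ker {0..<int H} a l b"
        unfolding q_def using ker_overshoot[OF KH L l] True by auto
    qed (use q v0 in auto)
    also have "\<dots> = walks (\<lambda>_. {0..<int H}) (\<lambda>a. q ^ j * v a) l b"
      by (rule walks_superposition[symmetric]) (use v KH in auto)
    also have "\<dots> \<le> walks (\<lambda>_. {0..<int H}) (ker {0..<int H} 0 (s j)) l b"
      by (rule walks_mono) (use Suc in \<open>auto simp: q_def v_def ker_nonneg\<close>)
    also have "\<dots> = ker {0..<int H} 0 (s (Suc j)) b"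
      unfolding sj ker_def walks_add ..
    finally show ?thesis by (simp add: q_def)
  qed
qed

lemma dyck_prob_grid:
  assumes s: "s 0 = 0" "\<And>j. j < m \<Longrightarrow> s j \<le> s (Suc j)" "\<And>j. j < m \<Longrightarrow> s (Suc j) - s j \<le> L" "s m = 2 * n"
    and KH: "K < H" and L: "0 < L" and le: "overshoot L K H \<le> 1"
  shows "(1 - overshoot L K H) ^ m * dyck_prob n {S. \<forall>j\<le>m. S ! (s j) \<le> int K}
           \<le> dyck_prob n {S. path_max S < int H}"
proof -
  define Z where "Z = (\<lambda>r. {x. 0 \<le> x \<and> (\<forall>j\<le>m. s j = r \<longrightarrow> x \<le> int K)})"
  have "s j \<le> s m" if "j \<le> m" for j
    using that by (induction rule: inc_induct) (use s(2) le_trans in blast)+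
  then have "dyck_prob n {S. \<forall>j\<le>m. S ! (s j) \<le> int K} = dyck_prob n {S. \<forall>j\<le>2*n. S ! j \<in> Z j}"
    using s(4) by (intro dyck_prob_cong) (auto simp: Z_def dyck_pathD(4))
  also have "\<dots> = walks Z (\<lambda>b. of_bool (b = 0)) (2 * n) 0 / ker {0..} 0 (2 * n) 0"
    by (rule dyck_prob_walks) (auto simp: Z_def)
  finally have eq: "dyck_prob n {S. \<forall>j\<le>m. S ! (s j) \<le> int K} =
     walks Z (\<lambda>b. of_bool (b = 0)) (2 * n) 0 / ker {0..} 0 (2 * n) 0" .
  have "(1 - overshoot L K H) ^ m * walks Z (\<lambda>b. of_bool (b = 0)) (2 * n) 0 \<le> ker {0..<int H} 0 (2 * n) 0"
    using grid_walks[OF s(1-3) KH L le Z_def order_refl, where b = 0] s(4) by simp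
  then show ?thesis
    using KH unfolding eq by (simp add: dyck_prob_max_less divide_right_mono ker_nonneg)
qed

section \<open>Walks pinned at the times of a grid\<close>

lemma walks_last:
  assumes "0 < i" "\<And>j. 0 < j \<Longrightarrow> j < i \<Longrightarrow> Z j = X" "Z i \<subseteq> X"
  shows "walks Z v i b = (if b \<in> Z i then walks (\<lambda>_. X) v i b else 0)"
proof (cases i)
  case (Suc j)
  then have "walks Z v j c = walks (\<lambda>_. X) v j c" for c
    using assms by (intro walks_cong) auto
  then show ?thesis using Suc assms by auto
qed (use assms in simp)

text \<open>The Markov property for counts: pinning the value at \<open>s (Suc i)\<close> to
  \<open>c i\<close> makes the count a product of kernels over \<open>k + 2\<close> blocks. Strict
  monotonicity of \<open>s\<close> keeps the pinned times distinct and away from the end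
  \<open>s m\<close>, so that inside a block only nonnegativity remains. The index shift leaves
  \<open>s 0 = 0\<close> unpinned.\<close>

lemma pinned_walks:
  assumes s: "s 0 = 0" "strict_mono_on {..m} s" and m: "m = k + 2"
    and c: "\<And>i. i \<le> k \<Longrightarrow> 0 \<le> c i"
    and Z: "Z = (\<lambda>r. {x. 0 \<le> x \<and> (\<forall>i\<le>k. s (Suc i) = r \<longrightarrow> x = c i)})"
  shows "j \<le> k \<Longrightarrow> walks Z (\<lambda>b. of_bool (b = 0)) (s (Suc j)) b =
           ker {0..} 0 (s 1) (c 0) * (\<Prod>i<j. ker {0..} (c i) (s (i + 2) - s (i + 1)) (c (i + 1)))
             * of_bool (b = c j)"
    and "walks Z (\<lambda>b. of_bool (b = 0)) (s m) 0 =
           ker {0..} 0 (s 1) (c 0) * (\<Prod>i<k. ker {0..} (c i) (s (i + 2) - s (i + 1)) (c (i + 1)))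
             * ker {0..} (c k) (s m - s (Suc k)) 0"
proof -
  let ?w = "walks Z (\<lambda>b. of_bool (b = 0))"
  have lt: "s i < s j" if "i < j" "j \<le> m" for i j
    using s(2) that by (auto simp: strict_mono_on_def)
  have inj: "s i = s j \<longleftrightarrow> i = j" if "i \<le> m" "j \<le> m" for i j
    using lt[of i j] lt[of j i] that by (metis nat_neq_iff)
  have between: "Z (s j + r) = {0..}" if "j < m" "0 < r" "r < s (Suc j) - s j" for j r
  proof -
    have "s (Suc i) \<noteq> s j + r" if "i \<le> k" for i
    proof (cases "Suc i \<le> j")
      case True
      then have "s (Suc i) \<le> s j" using lt[of "Suc i" j] \<open>j < m\<close> by (cases "Suc i = j") auto
      then show ?thesis using \<open>0 < r\<close> by simp
    next
      case False
      then have "s (Suc j) \<le> s (Suc i)"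
        using lt[of "Suc j" "Suc i"] that m by (cases "i = j") auto
      then show ?thesis using \<open>r < _\<close> by simp
    qed
    then show ?thesis unfolding Z by auto
  qed
  have block: "?w (s (Suc j)) b = (if b \<in> Z (s (Suc j)) then walks (\<lambda>_. {0..}) (?w (s j)) (s (Suc j) - s j) b else 0)"
    if "j < m" for j b
  proof -
    have "s j < s (Suc j)" using lt[of j "Suc j"] that by simp
    then have "?w (s (Suc j)) b = walks (\<lambda>k. Z (s j + k)) (?w (s j)) (s (Suc j) - s j) b"
      by (simp flip: walks_add)
    also have "\<dots> = (if b \<in> Z (s (Suc j)) then walks (\<lambda>_. {0..}) (?w (s j)) (s (Suc j) - s j) b else 0)"
      using \<open>s j < s (Suc j)\<close> between[OF that] by (subst walks_last[where X = "{0..}"]) (auto simp: Z)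
    finally show ?thesis .
  qed
  have pin: "Z (s (Suc j)) = {c j}" if "j \<le> k" for j
    using that c[OF that] m unfolding Z by (auto simp: inj)
  \<comment> \<open>After a pin the weight is a multiple of a point mass, so the next block
    contributes a single kernel.\<close>
  have from_pin: "walks (\<lambda>_. {0..}) (\<lambda>b. C * of_bool (b = a)) i b = C * ker {0..} a i b" if "0 \<le> a" for C a i b
    using that by (simp add: walks_scale ker_def)
  have start [simp]: "?w 0 = (\<lambda>b. of_bool (b = 0))" by auto
  show main: "?w (s (Suc j)) b =
           ker {0..} 0 (s 1) (c 0) * (\<Prod>i<j. ker {0..} (c i) (s (i + 2) - s (i + 1)) (c (i + 1)))
             * of_bool (b = c j)" if "j \<le> k" for j b
    using that
  proof (induction j arbitrary: b)
    case 0
    then show ?case using block[of 0 b] pin[of 0] m s(1) by (simp add: walks_start)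
  next
    case (Suc j)
    define C where "C = ker {0..} 0 (s 1) (c 0) * (\<Prod>i<j. ker {0..} (c i) (s (i + 2) - s (i + 1)) (c (i + 1)))"
    have "?w (s (Suc j)) = (\<lambda>b. C * of_bool (b = c j))"
      using Suc by (auto simp: C_def)
    then have "?w (s (Suc (Suc j))) b =
        (if b = c (Suc j) then C * ker {0..} (c j) (s (Suc (Suc j)) - s (Suc j)) b else 0)"
      using block[of "Suc j" b] pin[of "Suc j"] Suc.prems m from_pin[OF c[of j], of C] by simp
    then show ?case by (simp add: C_def mult.assoc)
  qed
  have "0 \<in> Z (s m)" using inj m by (auto simp: Z)
  moreover have "?w (s (Suc k)) = (\<lambda>b. ker {0..} 0 (s 1) (c 0) * (\<Prod>i<k. ker {0..} (c i) (s (i + 2) - s (i + 1)) (c (i + 1)))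
             * of_bool (b = c k))"
    using main[OF order_refl] by auto
  ultimately show "?w (s m) 0 =
           ker {0..} 0 (s 1) (c 0) * (\<Prod>i<k. ker {0..} (c i) (s (i + 2) - s (i + 1)) (c (i + 1)))
             * ker {0..} (c k) (s m - s (Suc k)) 0"
    using block[of "Suc k" 0] m from_pin[OF c[of k]] by simp
qed

lemma dyck_prob_pinned:
  assumes s: "s 0 = 0" "strict_mono_on {..k + 2} s" "s (k + 2) = 2 * n"
    and c: "\<And>i. i \<le> k \<Longrightarrow> 0 \<le> c i"
  shows "dyck_prob n {S. \<forall>i\<le>k. S ! (s (Suc i)) = c i} =
           ker {0..} 0 (s 1) (c 0) * (\<Prod>i<k. ker {0..} (c i) (s (i + 2) - s (i + 1)) (c (i + 1)))
             * ker {0..} (c k) (2 * n - s (Suc k)) 0 / ker {0..} 0 (2 * n) 0"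
proof -
  define Z where "Z = (\<lambda>r. {x. 0 \<le> x \<and> (\<forall>i\<le>k. s (Suc i) = r \<longrightarrow> x = c i)})"
  have lt: "s i < s j" if "i < j" "j \<le> k + 2" for i j
    using s(2) that by (auto simp: strict_mono_on_def)
  have "s (Suc i) \<le> 2 * n" "s (Suc i) \<noteq> 0" if "i \<le> k" for i
    using lt[of "Suc i" "k + 2"] lt[of 0 "Suc i"] s that by auto
  then have "dyck_prob n {S. \<forall>i\<le>k. S ! (s (Suc i)) = c i} = dyck_prob n {S. \<forall>j\<le>2*n. S ! j \<in> Z j}"
    by (intro dyck_prob_cong) (auto simp: Z_def dyck_pathD(4))
  also have "\<dots> = walks Z (\<lambda>b. of_bool (b = 0)) (2 * n) 0 / ker {0..} 0 (2 * n) 0"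
    by (intro dyck_prob_walks) (auto simp: Z_def dest!: \<open>\<And>i. i \<le> k \<Longrightarrow> s (Suc i) \<noteq> 0\<close>)
  also have "walks Z (\<lambda>b. of_bool (b = 0)) (2 * n) 0 =
           ker {0..} 0 (s 1) (c 0) * (\<Prod>i<k. ker {0..} (c i) (s (i + 2) - s (i + 1)) (c (i + 1)))
             * ker {0..} (c k) (2 * n - s (Suc k)) 0"
    using pinned_walks(2)[OF s(1,2) refl c Z_def] s(3) by simp
  finally show ?thesis .
qed

section \<open>Local limit theorem\<close>

text \<open>Expresses the central binomial coefficient through a generalized one, whose asymptotics
  in \<open>n\<close> are governed by the Gamma function.\<close>

lemma gbinomial_minus_half:
  "((- 1 / 2 :: real) gchoose n) = (- 1) ^ n * real ((2 * n) choose n) / 4 ^ n"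
proof (induction n)
  case (Suc n)
  have "(- 1 / 2) * ((- 1 / 2 :: real) gchoose n) =
     real n * ((- 1 / 2) gchoose n) + real (Suc n) * ((- 1 / 2) gchoose Suc n)"
    by (rule gbinomial_mult_1)
  then have g: "((- 1 / 2 :: real) gchoose Suc n) = - (2 * real n + 1) / (2 * real (Suc n)) * ((- 1 / 2) gchoose n)"
    by (simp add: field_simps)
  have c: "real ((2 * Suc n) choose Suc n) = 2 * (2 * real n + 1) / real (Suc n) * real ((2 * n) choose n)"
  proof -
    have *: "real ((2 * m) choose m) = fact (2 * m) / (fact m)\<^sup>2" for m
      by (subst binomial_fact) (simp_all add: power2_eq_square mult_2)
    have "2 * Suc n = Suc (Suc (2 * n))" by simp
    then have f: "fact (2 * Suc n) = 2 * real (Suc n) * (2 * real n + 1) * fact (2 * n)"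
      by (simp add: algebra_simps)
    define r where "r = 2 * real n + 1"
    show ?thesis unfolding * f fact_Suc[of n] r_def[symmetric]
      by (simp add: power2_eq_square mult_ac del: of_nat_Suc fact_Suc)
  qed
  show ?case unfolding g c Suc.IH by (simp add: divide_simps) (simp add: algebra_simps)
qed simp

lemma central_binomial_limit: "(\<lambda>n. sqrt (real n) * (real ((2 * n) choose n) / 4 ^ n)) \<longlonglongrightarrow> 1 / sqrt pi"
proof (rule Lim_transform_eventually)
  \<comment> \<open>\<open>gbinomial_asymptotic\<close> at -1/2 has the limit
    \<open>1 / Gamma (1 / 2)\<close>, and \<open>Gamma (1 / 2) = sqrt pi\<close>.\<close>
  show "(\<lambda>n. ((- 1 / 2 :: real) gchoose n) / ((- 1) ^ n / exp ((- 1 / 2 + 1) * of_real (ln (real n))))) \<longlonglongrightarrow> 1 / sqrt pi"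
    using gbinomial_asymptotic[of "- 1 / 2 :: real"]
    by (simp add: Gamma_one_half_real inverse_eq_divide)
  show "\<forall>\<^sub>F n in sequentially. ((- 1 / 2 :: real) gchoose n) / ((- 1) ^ n / exp ((- 1 / 2 + 1) * of_real (ln (real n)))) =
     sqrt (real n) * (real ((2 * n) choose n) / 4 ^ n)"
    using eventually_gt_at_top[of 0]
  proof eventually_elim
    case (elim n)
    have "exp (ln (real n) / 2) = sqrt (real n)"
      using elim exp_ln[of "sqrt (real n)"] by (simp add: ln_sqrt)
    moreover have "((- 1) ^ n * (- 1) ^ n :: real) = 1"
      by (simp flip: power_mult_distrib)
    ultimately show ?case unfolding gbinomial_minus_half by (simp add: field_simps)
  qed
qed

text \<open>De Moivre-Laplace: the central coefficient gives the prefactor, and the quotient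
  \<open>R\<close> is squeezed between the two Gaussian bounds. Their denominators
  \<open>l n - k n\<close> and \<open>l n + k n\<close> are both equivalent to \<open>l n\<close>,
  because \<open>k n\<close> is at most of order \<open>sqrt n\<close>.\<close>

lemma srw_local_limit:
  fixes l :: "nat \<Rightarrow> nat" and c :: "nat \<Rightarrow> int"
  assumes l: "(\<lambda>n. real (l n) / real n) \<longlonglongrightarrow> \<tau>" "\<tau> > 0"
    and c: "(\<lambda>n. real_of_int (c n) / sqrt (real n)) \<longlonglongrightarrow> z"
  shows "(\<lambda>n. sqrt (real n) * (srw (2 * l n) (2 * c n) / 4 ^ l n)) \<longlonglongrightarrow> exp (- z\<^sup>2 / \<tau>) / sqrt (pi * \<tau>)"
proof -
  define k where "k n = nat \<bar>c n\<bar>" for n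
  define R where "R n = real ((2 * l n) choose (l n + k n)) / real ((2 * l n) choose l n)" for n
  have l_inf: "filterlim (\<lambda>n. real (l n)) at_top sequentially"
  proof (rule filterlim_mono_eventually)
    show "filterlim (\<lambda>n. real (l n) / real n * real n) at_top sequentially"
      by (rule filterlim_tendsto_pos_mult_at_top[OF l]) real_asymp
    show "\<forall>\<^sub>F n in sequentially. real (l n) / real n * real n = real (l n)"
      using eventually_gt_at_top[of 0] by eventually_elim simp
  qed auto
  then have l_inf': "filterlim l at_top sequentially"
    by (simp add: filterlim_sequentially_iff_filterlim_real)
  have k: "(\<lambda>n. real (k n) / sqrt (real n)) \<longlonglongrightarrow> \<bar>z\<bar>"
    using tendsto_rabs[OF c] by (simp add: k_def)
  have k': "(\<lambda>n. real (k n) / real n) \<longlonglongrightarrow> 0"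
  proof -
    have "(\<lambda>n. (real (k n) / sqrt (real n)) * (1 / sqrt (real n))) \<longlonglongrightarrow> \<bar>z\<bar> * 0"
      by (intro tendsto_mult k) real_asymp
    then show ?thesis by (simp add: real_sqrt_mult_self divide_divide_eq_left)
  qed
  have "(\<lambda>n. real (k n) / real n - real (l n) / real n) \<longlonglongrightarrow> 0 - \<tau>"
    by (intro tendsto_intros k' l)
  then have "\<forall>\<^sub>F n in sequentially. real (k n) / real n - real (l n) / real n < 0"
    by (rule order_tendstoD) (use l in simp)
  then have kl: "\<forall>\<^sub>F n in sequentially. k n < l n \<and> 0 < n"
    using eventually_gt_at_top[of 0] by eventually_elim (simp add: field_simps)
  have R: "R \<longlonglongrightarrow> exp (- z\<^sup>2 / \<tau>)"
  proof (rule tendsto_sandwich)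
    have "(\<lambda>n. exp (- (real (k n) / sqrt (real n))\<^sup>2 / (real (l n) / real n - real (k n) / real n))) \<longlonglongrightarrow> exp (- \<bar>z\<bar>\<^sup>2 / (\<tau> - 0))"
      by (intro tendsto_intros k k' l) (use l in auto)
    moreover have "(\<lambda>n. exp (- (real (k n) / sqrt (real n))\<^sup>2 / (real (l n) / real n + real (k n) / real n))) \<longlonglongrightarrow> exp (- \<bar>z\<bar>\<^sup>2 / (\<tau> + 0))"
      by (intro tendsto_intros k k' l) (use l in auto)
    ultimately show
      "(\<lambda>n. exp (- (real (k n) / sqrt (real n))\<^sup>2 / (real (l n) / real n - real (k n) / real n))) \<longlonglongrightarrow> exp (- z\<^sup>2 / \<tau>)"
      "(\<lambda>n. exp (- (real (k n) / sqrt (real n))\<^sup>2 / (real (l n) / real n + real (k n) / real n))) \<longlonglongrightarrow> exp (- z\<^sup>2 / \<tau>)"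
      by simp_all
    show "\<forall>\<^sub>F n in sequentially. exp (- (real (k n) / sqrt (real n))\<^sup>2 / (real (l n) / real n - real (k n) / real n)) \<le> R n"
      using kl
    proof eventually_elim
      case (elim n)
      have "(real (k n) / sqrt (real n))\<^sup>2 / (real (l n) / real n - real (k n) / real n) = (real (k n))\<^sup>2 / real (l n - k n)"
        using elim by (simp add: power_divide of_nat_diff field_simps flip: diff_divide_distrib)
      then show ?case
        using central_binomial_quotient_lower[of "k n" "k n" "l n"] elim
        by (simp add: R_def field_simps)
    qed
    show "\<forall>\<^sub>F n in sequentially. R n \<le> exp (- (real (k n) / sqrt (real n))\<^sup>2 / (real (l n) / real n + real (k n) / real n))"
      using kl
    proof eventually_elim
      case (elim n)
      have "(real (k n) / sqrt (real n))\<^sup>2 / (real (l n) / real n + real (k n) / real n) = (real (k n))\<^sup>2 / real (l n + k n)"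
        using elim by (simp add: power_divide field_simps flip: add_divide_distrib)
      then show ?case
        using central_binomial_quotient_upper[of "k n" "k n" "l n"] elim
        by (simp add: R_def field_simps)
    qed
  qed
  have "(\<lambda>n. inverse (sqrt (real (l n) / real n)) * (sqrt (real (l n)) * (real ((2 * l n) choose l n) / 4 ^ l n)) * R n)
      \<longlonglongrightarrow> inverse (sqrt \<tau>) * (1 / sqrt pi) * exp (- z\<^sup>2 / \<tau>)"
    by (intro tendsto_intros R l filterlim_compose[OF central_binomial_limit l_inf']) (use l in simp)
  also have "inverse (sqrt \<tau>) * (1 / sqrt pi) * exp (- z\<^sup>2 / \<tau>) = exp (- z\<^sup>2 / \<tau>) / sqrt (pi * \<tau>)"
    by (simp add: real_sqrt_mult field_simps)
  finally show ?thesis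
  proof (rule Lim_transform_eventually)
    show "\<forall>\<^sub>F n in sequentially. inverse (sqrt (real (l n) / real n)) * (sqrt (real (l n)) * (real ((2 * l n) choose l n) / 4 ^ l n)) * R n
       = sqrt (real n) * (srw (2 * l n) (2 * c n) / 4 ^ l n)"
      using kl
    proof eventually_elim
      case (elim n)
      have "srw (2 * l n) (2 * c n) = srw (2 * l n) (2 * int (k n))"
        using srw_minus[of "2 * l n" "2 * c n"] by (cases "0 \<le> c n") (auto simp: k_def)
      also have "\<dots> = real ((2 * l n) choose (l n + k n))" by (rule srw_even_binomial)
      finally show ?case using elim by (simp add: R_def real_sqrt_divide field_simps)
    qed
  qed
qed

text \<open>From 0 the two terms of the reflection formula are consecutive binomial coefficients, so
  their difference is an explicit fraction of the first. The exact form matters because both terms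
  have the same local limit.\<close>

lemma ker_from_0:
  assumes "0 \<le> c"
  shows "ker {0..} 0 (2 * l) (2 * c) =
           srw (2 * l) (2 * c) * ((2 * real_of_int c + 1) / (real l + real_of_int c + 1))"
proof -
  obtain k where k: "c = int k" using assms nonneg_int_cases by blast
  have "ker {0..} 0 (2 * l) (2 * c) = srw (2 * l) (2 * int k) - srw (2 * l) (2 * int (Suc k))"
    using assms by (subst ker_nonneg_reflection) (auto simp: k algebra_simps)
  also have "\<dots> = real ((2 * l) choose (l + k)) - real ((2 * l) choose Suc (l + k))"
    unfolding srw_even_binomial by simp
  also have "real ((2 * l) choose Suc (l + k)) = (real l - real k) / real (Suc (l + k)) * real ((2 * l) choose (l + k))"
  proof (cases "k \<le> l")
    case True
    then show ?thesis using central_binomial_step[OF True] by (simp add: field_simps)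
  qed (simp add: binomial_eq_0)
  finally show ?thesis
    unfolding k srw_even_binomial by (simp add: field_simps)
qed

text \<open>In these units the height \<open>2 * c n\<close> divided by \<open>sqrt (2 * n)\<close>
  tends to \<open>y\<close>. The fraction from \<open>ker_from_0\<close>, multiplied by
  \<open>sqrt n\<close>, tends to \<open>sqrt 2 * y / \<tau>\<close>, which raises the normalization
  from \<open>sqrt n\<close> to \<open>n\<close>.\<close>

lemma entrance_limit:
  fixes l :: "nat \<Rightarrow> nat" and c :: "nat \<Rightarrow> int"
  assumes l: "(\<lambda>n. real (l n) / real n) \<longlonglongrightarrow> \<tau>" "\<tau> > 0"
    and c: "(\<lambda>n. real_of_int (c n) / sqrt (real n)) \<longlonglongrightarrow> y / sqrt 2" "\<And>n. 0 \<le> c n"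
  shows "(\<lambda>n. real n * (ker {0..} 0 (2 * l n) (2 * c n) / 4 ^ l n)) \<longlonglongrightarrow> entrance_density \<tau> y"
proof -
  let ?c = "\<lambda>n. real_of_int (c n) / sqrt (real n)"
  have o: "(\<lambda>n. 1 / sqrt (real n)) \<longlonglongrightarrow> 0" by real_asymp
  have "(\<lambda>n. sqrt (real n) * (srw (2 * l n) (2 * c n) / 4 ^ l n) *
     ((2 * ?c n + 1 / sqrt (real n)) / (real (l n) / real n + ?c n * (1 / sqrt (real n)) + 1 / sqrt (real n) * (1 / sqrt (real n)))))
    \<longlonglongrightarrow> exp (- (y / sqrt 2)\<^sup>2 / \<tau>) / sqrt (pi * \<tau>) * ((2 * (y / sqrt 2) + 0) / (\<tau> + (y / sqrt 2) * 0 + 0 * 0))"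
    by (intro tendsto_intros srw_local_limit l c o) (use l in simp)
  also have "exp (- (y / sqrt 2)\<^sup>2 / \<tau>) / sqrt (pi * \<tau>) * ((2 * (y / sqrt 2) + 0) / (\<tau> + (y / sqrt 2) * 0 + 0 * 0))
     = entrance_density \<tau> y"
    using l(2) by (simp add: entrance_density_def normal_density_def power_divide real_sqrt_mult field_simps)
  finally show ?thesis
  proof (rule Lim_transform_eventually)
    show "\<forall>\<^sub>F n in sequentially. sqrt (real n) * (srw (2 * l n) (2 * c n) / 4 ^ l n) *
     ((2 * ?c n + 1 / sqrt (real n)) / (real (l n) / real n + ?c n * (1 / sqrt (real n)) + 1 / sqrt (real n) * (1 / sqrt (real n))))
      = real n * (ker {0..} 0 (2 * l n) (2 * c n) / 4 ^ l n)"
      using eventually_gt_at_top[of 0]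
    proof eventually_elim
      case (elim n)
      have "real (l n) / real n + ?c n * (1 / sqrt (real n)) + 1 / sqrt (real n) * (1 / sqrt (real n)) =
        (real (l n) + real_of_int (c n) + 1) / real n"
        by (simp add: add_divide_distrib)
      moreover have "2 * ?c n + 1 / sqrt (real n) = (2 * real_of_int (c n) + 1) / sqrt (real n)"
        by (simp add: add_divide_distrib)
      ultimately show ?case using elim c(2)[of n] unfolding ker_from_0[OF c(2)] by (simp add: mult_ac)
    qed
  qed
qed

text \<open>The count is the Catalan number.\<close>

lemma dyck_count_limit:
  "(\<lambda>n. real n * sqrt (real n) * (ker {0..} 0 (2 * n) 0 / 4 ^ n)) \<longlonglongrightarrow> 1 / sqrt pi"
proof -
  have "(\<lambda>n. sqrt (real n) * (real ((2 * n) choose n) / 4 ^ n) * (real n / (real n + 1))) \<longlonglongrightarrow> 1 / sqrt pi * 1"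
    by (intro tendsto_mult central_binomial_limit) real_asymp
  moreover have "ker {0..} 0 (2 * n) 0 = real ((2 * n) choose n) / (real n + 1)" for n
    using ker_from_0[of 0 n] srw_even_binomial[of n 0] by simp
  ultimately show ?thesis by (simp add: mult_ac)
qed

text \<open>Both terms of the reflection formula converge by the local limit theorem. Even heights
  divided by \<open>sqrt (2 * n)\<close> have \<open>sqrt (n / 2)\<close> points per unit of length,
  hence the normalization.\<close>

lemma killed_limit:
  fixes l :: "nat \<Rightarrow> nat" and c d :: "nat \<Rightarrow> int"
  assumes l: "(\<lambda>n. real (l n) / real n) \<longlonglongrightarrow> \<tau>" "\<tau> > 0"
    and c: "(\<lambda>n. real_of_int (c n) / sqrt (real n)) \<longlonglongrightarrow> x / sqrt 2" "\<And>n. 0 \<le> c n"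
    and d: "(\<lambda>n. real_of_int (d n) / sqrt (real n)) \<longlonglongrightarrow> y / sqrt 2" "\<And>n. 0 \<le> d n"
  shows "(\<lambda>n. sqrt (real n / 2) * (ker {0..} (2 * c n) (2 * l n) (2 * d n) / 4 ^ l n)) \<longlonglongrightarrow> killed_density \<tau> x y"
proof -
  have "(\<lambda>n. real_of_int (d n) / sqrt (real n) - real_of_int (c n) / sqrt (real n)) \<longlonglongrightarrow> y / sqrt 2 - x / sqrt 2"
    by (intro tendsto_intros c d)
  then have 1: "(\<lambda>n. real_of_int (d n - c n) / sqrt (real n)) \<longlonglongrightarrow> (y - x) / sqrt 2"
    by (simp add: diff_divide_distrib)
  have "(\<lambda>n. real_of_int (d n) / sqrt (real n) + real_of_int (c n) / sqrt (real n) + 1 / sqrt (real n)) \<longlonglongrightarrow> y / sqrt 2 + x / sqrt 2 + 0"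
    by (intro tendsto_add c d) real_asymp
  then have 2: "(\<lambda>n. real_of_int (d n + c n + 1) / sqrt (real n)) \<longlonglongrightarrow> (y + x) / sqrt 2"
    by (simp add: add_divide_distrib)
  have "(\<lambda>n. (1 / sqrt 2) * (sqrt (real n) * (srw (2 * l n) (2 * (d n - c n)) / 4 ^ l n)
            - sqrt (real n) * (srw (2 * l n) (2 * (d n + c n + 1)) / 4 ^ l n))) \<longlonglongrightarrow>
       (1 / sqrt 2) * (exp (- ((y - x) / sqrt 2)\<^sup>2 / \<tau>) / sqrt (pi * \<tau>) - exp (- ((y + x) / sqrt 2)\<^sup>2 / \<tau>) / sqrt (pi * \<tau>))"
    by (intro tendsto_intros srw_local_limit l 1 2)
  also have "(1 / sqrt 2) * (exp (- ((y - x) / sqrt 2)\<^sup>2 / \<tau>) / sqrt (pi * \<tau>) - exp (- ((y + x) / sqrt 2)\<^sup>2 / \<tau>) / sqrt (pi * \<tau>)) = killed_density \<tau> x y"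
    using l(2) by (simp add: killed_density_def normal_density_def power_divide real_sqrt_mult right_diff_distrib mult_ac)
  also have "(\<lambda>n. (1 / sqrt 2) * (sqrt (real n) * (srw (2 * l n) (2 * (d n - c n)) / 4 ^ l n)
            - sqrt (real n) * (srw (2 * l n) (2 * (d n + c n + 1)) / 4 ^ l n))) =
      (\<lambda>n. sqrt (real n / 2) * (ker {0..} (2 * c n) (2 * l n) (2 * d n) / 4 ^ l n))"
  proof
    fix n
    have "ker {0..} (2 * c n) (2 * l n) (2 * d n) = srw (2 * l n) (2 * (d n - c n)) - srw (2 * l n) (2 * (d n + c n + 1))"
      using c(2)[of n] d(2)[of n] by (subst ker_nonneg_reflection) (auto simp: algebra_simps)
    then show "(1 / sqrt 2) * (sqrt (real n) * (srw (2 * l n) (2 * (d n - c n)) / 4 ^ l n)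
            - sqrt (real n) * (srw (2 * l n) (2 * (d n + c n + 1)) / 4 ^ l n)) =
        sqrt (real n / 2) * (ker {0..} (2 * c n) (2 * l n) (2 * d n) / 4 ^ l n)"
      by (simp add: real_sqrt_divide right_diff_distrib diff_divide_distrib)
  qed
  finally show ?thesis .
qed

text \<open>The largest even time that does not exceed \<open>2 * n * j / m\<close>. At even times
  the heights of a path are even, so that no parity condition enters the local limits.\<close>

abbreviation grid :: "nat \<Rightarrow> nat \<Rightarrow> nat \<Rightarrow> nat" where
  "grid m n j \<equiv> 2 * ((n * j) div m)"

lemma grid_limit:
  assumes "0 < m"
  shows "(\<lambda>n. real ((n * j) div m) / real n) \<longlonglongrightarrow> real j / real m"
proof (rule tendsto_sandwich)
  show "(\<lambda>n. real j / real m - 1 / real n) \<longlonglongrightarrow> real j / real m" by real_asymp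
  show "(\<lambda>n. real j / real m) \<longlonglongrightarrow> real j / real m" by simp
  have b: "real (n * j) / real m - 1 \<le> real ((n * j) div m)" "real ((n * j) div m) \<le> real (n * j) / real m" for n
  proof -
    have "real ((n * j) div m) = of_int \<lfloor>real (n * j) / real m\<rfloor>"
      by (simp only: floor_divide_of_nat_eq of_int_of_nat_eq)
    then show "real (n * j) / real m - 1 \<le> real ((n * j) div m)" "real ((n * j) div m) \<le> real (n * j) / real m"
      by linarith+
  qed
  show "\<forall>\<^sub>F n in sequentially. real j / real m - 1 / real n \<le> real ((n * j) div m) / real n"
    using eventually_gt_at_top[of 0]
  proof eventually_elim
    case (elim n)
    have "(real (n * j) / real m - 1) / real n \<le> real ((n * j) div m) / real n"
      by (intro divide_right_mono b) simp
    then show ?case using elim by (simp add: diff_divide_distrib)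
  qed
  show "\<forall>\<^sub>F n in sequentially. real ((n * j) div m) / real n \<le> real j / real m"
    using eventually_gt_at_top[of 0]
  proof eventually_elim
    case (elim n)
    have "real ((n * j) div m) / real n \<le> (real (n * j) / real m) / real n"
      by (intro divide_right_mono b) simp
    then show ?case using elim by simp
  qed
qed

lemma grid_step_limit:
  assumes "0 < m"
  shows "(\<lambda>n. real ((n * Suc j) div m - (n * j) div m) / real n) \<longlonglongrightarrow> 1 / real m"
proof -
  have "(\<lambda>n. real ((n * Suc j) div m) / real n - real ((n * j) div m) / real n) \<longlonglongrightarrow> real (Suc j) / real m - real j / real m"
    by (intro tendsto_diff grid_limit assms)
  moreover have "(n * j) div m \<le> (n * Suc j) div m" for n by (simp add: div_le_mono)
  ultimately show ?thesis by (simp add: of_nat_diff diff_divide_distrib add_divide_distrib)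
qed

lemma grid_strict:
  assumes "0 < m" "m \<le> n"
  shows "strict_mono (grid m n)"
proof (rule strict_mono_Suc_iff[THEN iffD2], rule allI)
  fix j
  have "(n * j + m) div m \<le> (n * Suc j) div m" using assms by (intro div_le_mono) simp
  then show "grid m n j < grid m n (Suc j)" using assms by simp
qed

lemma grid_step_le:
  assumes "0 < m"
  shows "grid m n (Suc j) - grid m n j \<le> 2 * (n div m + 1)"
proof -
  have "(n * j + n) div m \<le> (n * j) div m + n div m + 1"
  proof -
    define q p where "q = (n * j) div m" and "p = n div m"
    have "n * j = m * q + (n * j) mod m" "n = m * p + n mod m" by (simp_all add: p_def q_def)
    moreover have "(n * j) mod m < m" "n mod m < m" using assms by simp_all
    moreover have "m * (q + p + 2) = m * q + m * p + 2 * m" by (simp add: algebra_simps)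
    ultimately have "n * j + n < m * (q + p + 2)" by linarith
    then have "(n * j + n) div m < q + p + 2"
      by (intro less_mult_imp_div_less) (simp add: mult.commute)
    then show ?thesis by (simp add: q_def p_def)
  qed
  then show ?thesis by (simp add: algebra_simps)
qed

lemma floor_scaled_limit:
  "(\<lambda>n. real_of_int \<lfloor>y * sqrt (real n / 2)\<rfloor> / sqrt (real n)) \<longlonglongrightarrow> y / sqrt 2"
proof (rule tendsto_sandwich)
  have "(\<lambda>n. y / sqrt 2 - 1 / sqrt (real n)) \<longlonglongrightarrow> y / sqrt 2 - 0"
    by (intro tendsto_diff tendsto_const) real_asymp
  then show "(\<lambda>n. y / sqrt 2 - 1 / sqrt (real n)) \<longlonglongrightarrow> y / sqrt 2" by simp
  show "(\<lambda>n. y / sqrt 2) \<longlonglongrightarrow> y / sqrt 2" by simp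
  show "\<forall>\<^sub>F n in sequentially. y / sqrt 2 - 1 / sqrt (real n) \<le> real_of_int \<lfloor>y * sqrt (real n / 2)\<rfloor> / sqrt (real n)"
    using eventually_gt_at_top[of 0]
  proof eventually_elim
    case (elim n)
    have "(y * sqrt (real n / 2) - 1) / sqrt (real n) \<le> real_of_int \<lfloor>y * sqrt (real n / 2)\<rfloor> / sqrt (real n)"
      by (intro divide_right_mono) (linarith, simp)
    then show ?case using elim by (simp add: diff_divide_distrib real_sqrt_divide)
  qed
  show "\<forall>\<^sub>F n in sequentially. real_of_int \<lfloor>y * sqrt (real n / 2)\<rfloor> / sqrt (real n) \<le> y / sqrt 2"
    using eventually_gt_at_top[of 0]
  proof eventually_elim
    case (elim n)
    have "real_of_int \<lfloor>y * sqrt (real n / 2)\<rfloor> / sqrt (real n) \<le> (y * sqrt (real n / 2)) / sqrt (real n)"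
      by (intro divide_right_mono) (linarith, simp)
    then show ?case using elim by (simp add: real_sqrt_divide)
  qed
qed

text \<open>Multiplied by \<open>sqrt (n / 2) ^ Suc k\<close> this is a step density: each
  \<open>y i\<close> is rounded down to an even height divided by \<open>sqrt (2 * n)\<close>, and
  the path must take these heights at the \<open>k + 1\<close> interior grid times.\<close>

definition cell_prob :: "nat \<Rightarrow> nat \<Rightarrow> (nat \<Rightarrow> real) \<Rightarrow> real" where
  "cell_prob k n y =
     dyck_prob n {S. \<forall>i\<le>k. S ! grid (k + 2) n (Suc i) = 2 * \<lfloor>y i * sqrt (real n / 2)\<rfloor>}"

abbreviation grid_time :: "nat \<Rightarrow> nat \<Rightarrow> real" where
  "grid_time k i \<equiv> real (Suc i) / real (k + 2)"

text \<open>By \<open>dyck_prob_pinned\<close> the probability is a quotient of kernels. Up to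
  powers of 4, which cancel, the two entrance kernels scale like \<open>1 / n\<close>, the
  \<open>k\<close> killed ones like \<open>1 / sqrt n\<close>, and the total count like
  \<open>1 / (n * sqrt n)\<close>.\<close>

lemma cell_prob_limit:
  assumes pos: "\<And>i. i \<le> k \<Longrightarrow> 0 < y i"
  shows "(\<lambda>n. sqrt (real n / 2) ^ Suc k * cell_prob k n y) \<longlonglongrightarrow> excursion_density k (grid_time k) y"
proof -
  define m where "m = k + 2"
  have m: "0 < m" by (simp add: m_def)
  define a where "a n j = (n * j) div m" for n j
  define c where "c n i = \<lfloor>y i * sqrt (real n / 2)\<rfloor>" for n i
  have mono: "a n i \<le> a n j" if "i \<le> j" for n i j
    using that by (simp add: a_def div_le_mono)
  have a0: "a n 0 = 0" and am: "a n m = n" for n using m by (simp_all add: a_def)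
  have c0: "0 \<le> c n i" if "i \<le> k" for n i
    using pos[OF that] by (simp add: c_def)
  have clim: "(\<lambda>n. real_of_int (c n i) / sqrt (real n)) \<longlonglongrightarrow> y i / sqrt 2" for i
    unfolding c_def by (rule floor_scaled_limit)
  have alim: "(\<lambda>n. real (a n (Suc j) - a n j) / real n) \<longlonglongrightarrow> 1 / real m" for j
    unfolding a_def by (rule grid_step_limit[OF m])
  have E0: "(\<lambda>n. real n * (ker {0..} 0 (2 * a n 1) (2 * c n 0) / 4 ^ a n 1)) \<longlonglongrightarrow> entrance_density (1 / real m) (y 0)"
    using entrance_limit[OF _ _ clim, of "\<lambda>n. a n 1" "1 / real m" 0] alim[of 0] a0 c0 m by simp
  have E1: "(\<lambda>n. real n * (ker {0..} 0 (2 * (a n m - a n (Suc k))) (2 * c n k) / 4 ^ (a n m - a n (Suc k)))) \<longlonglongrightarrow> entrance_density (1 / real m) (y k)"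
    using alim[of "Suc k"] c0 m by (intro entrance_limit clim) (auto simp: m_def)
  have Ki: "(\<lambda>n. sqrt (real n / 2) * (ker {0..} (2 * c n i) (2 * (a n (i + 2) - a n (i + 1))) (2 * c n (i + 1)) / 4 ^ (a n (i + 2) - a n (i + 1))))
       \<longlonglongrightarrow> killed_density (1 / real m) (y i) (y (Suc i))" if "i < k" for i
    using alim[of "Suc i"] c0 m clim[of "Suc i"] that by (intro killed_limit clim) auto
  \<comment> \<open>Since \<open>n * n / (n * sqrt n) = sqrt n\<close>, the factor
    \<open>1 / sqrt 2\<close> supplies the last \<open>sqrt (n / 2)\<close>. In the limit it
    combines with the division by \<open>1 / sqrt pi\<close> to the constant
    \<open>sqrt (pi / 2)\<close> of the excursion density.\<close>
  have "(\<lambda>n. 1 / sqrt 2 * (real n * (ker {0..} 0 (2 * a n 1) (2 * c n 0) / 4 ^ a n 1)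
           * (\<Prod>i<k. sqrt (real n / 2) * (ker {0..} (2 * c n i) (2 * (a n (i + 2) - a n (i + 1))) (2 * c n (i + 1)) / 4 ^ (a n (i + 2) - a n (i + 1))))
           * (real n * (ker {0..} 0 (2 * (a n m - a n (Suc k))) (2 * c n k) / 4 ^ (a n m - a n (Suc k))))
           / (real n * sqrt (real n) * (ker {0..} 0 (2 * n) 0 / 4 ^ n))))
     \<longlonglongrightarrow> 1 / sqrt 2 * (entrance_density (1 / real m) (y 0) * (\<Prod>i<k. killed_density (1 / real m) (y i) (y (Suc i)))
            * entrance_density (1 / real m) (y k) / (1 / sqrt pi))"
    by (intro tendsto_intros E0 E1 Ki dyck_count_limit) auto
  also have "1 / sqrt 2 * (entrance_density (1 / real m) (y 0) * (\<Prod>i<k. killed_density (1 / real m) (y i) (y (Suc i)))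
            * entrance_density (1 / real m) (y k) / (1 / sqrt pi)) = excursion_density k (grid_time k) y"
  proof -
    have "grid_time k (Suc i) - grid_time k i = 1 / real m" "grid_time k 0 = 1 / real m" "1 - grid_time k k = 1 / real m" for i
      by (simp_all add: m_def field_simps)
    then show ?thesis
      unfolding excursion_density_def using pos by (simp add: real_sqrt_divide)
  qed
  finally show ?thesis
  proof (rule Lim_transform_eventually)
    show "\<forall>\<^sub>F n in sequentially.
      1 / sqrt 2 * (real n * (ker {0..} 0 (2 * a n 1) (2 * c n 0) / 4 ^ a n 1)
           * (\<Prod>i<k. sqrt (real n / 2) * (ker {0..} (2 * c n i) (2 * (a n (i + 2) - a n (i + 1))) (2 * c n (i + 1)) / 4 ^ (a n (i + 2) - a n (i + 1))))
           * (real n * (ker {0..} 0 (2 * (a n m - a n (Suc k))) (2 * c n k) / 4 ^ (a n m - a n (Suc k))))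
           / (real n * sqrt (real n) * (ker {0..} 0 (2 * n) 0 / 4 ^ n)))
      = sqrt (real n / 2) ^ Suc k * cell_prob k n y"
      using eventually_ge_at_top[of m]
    proof eventually_elim
      case (elim n)
      have n: "0 < n" using elim m by simp
      have "cell_prob k n y = ker {0..} 0 (2 * a n 1) (2 * c n 0)
          * (\<Prod>i<k. ker {0..} (2 * c n i) (2 * a n (i + 2) - 2 * a n (i + 1)) (2 * c n (i + 1)))
             * ker {0..} (2 * c n k) (2 * n - 2 * a n (Suc k)) 0 / ker {0..} 0 (2 * n) 0"
        unfolding cell_prob_def a_def c_def m_def[symmetric]
      proof (rule dyck_prob_pinned)
        show "strict_mono_on {..k + 2} (grid m n)"
          by (rule monotone_on_subset[OF grid_strict[OF m elim] subset_UNIV])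
        show "grid m n (k + 2) = 2 * n"
          unfolding m_def[symmetric] using m by simp
      qed (use c0 in \<open>auto simp: c_def\<close>)
      \<comment> \<open>The last block is reversed, so that it too starts at 0, as in
        \<open>entrance_limit\<close>.\<close>
      also have "\<dots> = ker {0..} 0 (2 * a n 1) (2 * c n 0)
          * (\<Prod>i<k. ker {0..} (2 * c n i) (2 * (a n (i + 2) - a n (i + 1))) (2 * c n (i + 1)))
             * ker {0..} 0 (2 * (a n m - a n (Suc k))) (2 * c n k) / ker {0..} 0 (2 * n) 0"
        by (simp add: am ker_commute[of "{0..}" "2 * c n k"] diff_mult_distrib2)
      finally have cell: "cell_prob k n y = \<dots>" .
      \<comment> \<open>The block lengths telescope, hence so do the powers of 4.\<close>
      have "(\<Prod>i<k'. 4 ^ (a n (i + 2) - a n (i + 1))) = (4 :: real) ^ (a n (k' + 1) - a n 1)" for k'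
      proof (induction k')
        case (Suc k')
        then show ?case using mono[of 1 "k' + 1" n] mono[of "k' + 1" "k' + 2" n]
          by (simp flip: power_add)
      qed simp
      then have pow: "(4 :: real) ^ n = 4 ^ a n 1 * (\<Prod>i<k. 4 ^ (a n (i + 2) - a n (i + 1))) * 4 ^ (a n m - a n (Suc k))"
        using mono[of 1 "k + 1" n] mono[of "k + 1" m n] am[of n] by (simp add: m_def flip: power_add)
      have rearrange: "1 / sqrt 2 * (N * (A / p) * (C * (B / q)) * (N * (E / r)) / (N * sqrt N * (D / (p * q * r))))
          = (sqrt N / sqrt 2 * C) * (A * B * E / D)"
        if "0 < N" "p \<noteq> 0" "q \<noteq> 0" "r \<noteq> 0" "D \<noteq> 0" for N A B C D E p q r :: real
      proof -
        have "N / sqrt N = sqrt N" using that by (simp add: real_div_sqrt)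
        moreover have "1 / sqrt 2 * (N * (A / p) * (C * (B / q)) * (N * (E / r)) / (N * sqrt N * (D / (p * q * r))))
          = (N / sqrt N) / sqrt 2 * C * (A * B * E / D)"
          using that by (simp add: divide_simps)
        ultimately show ?thesis by simp
      qed
      have prod: "(\<Prod>i<k. sqrt (real n / 2) * (ker {0..} (2 * c n i) (2 * (a n (i + 2) - a n (i + 1))) (2 * c n (i + 1)) / 4 ^ (a n (i + 2) - a n (i + 1))))
         = sqrt (real n / 2) ^ k * ((\<Prod>i<k. ker {0..} (2 * c n i) (2 * (a n (i + 2) - a n (i + 1))) (2 * c n (i + 1))) / (\<Prod>i<k. 4 ^ (a n (i + 2) - a n (i + 1))))"
        by (simp only: prod.distrib prod_dividef prod_constant card_lessThan)
      have "(\<Prod>i<k. (4 :: real) ^ (a n (i + 2) - a n (i + 1))) \<noteq> 0" by simp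
      then show ?case
        unfolding cell prod pow using n dyck_count_pos[of n]
        by (subst rearrange) (simp_all add: real_sqrt_divide)
    qed
  qed
qed

section \<open>Rescaled grid densities and overshoots\<close>

lemma dyck_prob_eq_sum:
  "dyck_prob n B = (\<Sum>S\<in>dyck_paths (2 * n). indicator B S) / real (card (dyck_paths (2 * n)))"
  unfolding dyck_pmf_def
  by (simp add: measure_pmf_of_set dyck_paths_nonempty finite_dyck_paths indicator_def sum.If_cases Int_def)

context
  fixes k n :: nat and r :: real
  assumes n: "0 < n" and r: "r = sqrt (real n / 2)"
begin

text \<open>The uniform density on the interval of length \<open>1 / r\<close> whose points are
  rounded to the height of \<open>S\<close> at the grid time with index \<open>Suc i\<close>; an odd
  height gives 0.\<close>

definition cell_kernel :: "int list \<Rightarrow> nat \<Rightarrow> real \<Rightarrow> ennreal" where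
  "cell_kernel S i x = ennreal (r * indicator {x. S ! grid (k + 2) n (Suc i) = 2 * \<lfloor>x * r\<rfloor>} x)"

lemma cell_kernel_measurable [measurable]: "cell_kernel S i \<in> borel_measurable borel"
  unfolding cell_kernel_def by measurable

lemma cell_kernel_integral: "(\<integral>\<^sup>+ x. cell_kernel S i x \<partial>lborel) \<le> 1"
proof -
  define a where "a = real_of_int (S ! grid (k + 2) n (Suc i)) / 2"
  have r0: "0 < r" using n r by simp
  have "cell_kernel S i x \<le> ennreal r * indicator {a / r..(a + 1) / r} x" for x
  proof (cases "S ! grid (k + 2) n (Suc i) = 2 * \<lfloor>x * r\<rfloor>")
    case True
    then have "a = real_of_int \<lfloor>x * r\<rfloor>" by (simp add: a_def)
    then have "a \<le> x * r" "x * r \<le> a + 1" by linarith+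
    then have "x \<in> {a / r..(a + 1) / r}" using r0 by (simp add: field_simps)
    then show ?thesis using True by (simp add: cell_kernel_def)
  qed (simp add: cell_kernel_def)
  then have "(\<integral>\<^sup>+ x. cell_kernel S i x \<partial>lborel) \<le> (\<integral>\<^sup>+ x. ennreal r * indicator {a / r..(a + 1) / r} x \<partial>lborel)"
    by (intro nn_integral_mono)
  also have "\<dots> = ennreal r * ennreal ((a + 1) / r - a / r)"
    using r0 by (subst nn_integral_cmult_indicator) (auto simp: divide_right_mono)
  also have "\<dots> = 1"
    using r0 by (simp add: add_divide_distrib flip: ennreal_mult)
  finally show ?thesis .
qed

text \<open>The step density is the average over all Dyck paths of products of cell densities, so it
  is measurable and can be integrated coordinate by coordinate.\<close>

lemma cell_prob_kernel:
  "ennreal (r ^ Suc k * cell_prob k n y) =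
     (\<Sum>S\<in>dyck_paths (2 * n). ennreal (1 / real (card (dyck_paths (2 * n)))) * (\<Prod>i\<le>k. cell_kernel S i (y i)))"
proof -
  let ?D = "dyck_paths (2 * n)"
  have r0: "0 < r" using n r by simp
  have "r ^ Suc k * indicator {S. \<forall>i\<le>k. S ! grid (k + 2) n (Suc i) = 2 * \<lfloor>y i * r\<rfloor>} S
      = (\<Prod>i\<le>k. r * indicator {x. S ! grid (k + 2) n (Suc i) = 2 * \<lfloor>x * r\<rfloor>} (y i))" for S
    by (cases "\<forall>i\<le>k. S ! grid (k + 2) n (Suc i) = 2 * \<lfloor>y i * r\<rfloor>")
       (auto simp: indicator_def prod.distrib intro!: prod_zero)
  then have kernel: "ennreal (r ^ Suc k * indicator {S. \<forall>i\<le>k. S ! grid (k + 2) n (Suc i) = 2 * \<lfloor>y i * r\<rfloor>} S)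
      = (\<Prod>i\<le>k. cell_kernel S i (y i))" for S
    using r0 by (simp add: cell_kernel_def prod_ennreal del: power_Suc)
  have weighted: "ennreal (\<Sum>S\<in>?D. w * c S) = (\<Sum>S\<in>?D. ennreal w * ennreal (c S))"
    if "0 \<le> w" "\<And>S. 0 \<le> c S" for w c
    using that by (subst sum_ennreal[symmetric]) (auto simp: ennreal_mult)
  have "ennreal (r ^ Suc k * cell_prob k n y) = ennreal (\<Sum>S\<in>?D. 1 / real (card ?D) *
      (r ^ Suc k * indicator {S. \<forall>i\<le>k. S ! grid (k + 2) n (Suc i) = 2 * \<lfloor>y i * r\<rfloor>} S))"
    unfolding cell_prob_def dyck_prob_eq_sum r[symmetric]
    by (simp only: sum_distrib_left sum_divide_distrib times_divide_eq_left times_divide_eq_right mult_1_left)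
  also have "\<dots> = (\<Sum>S\<in>?D. ennreal (1 / real (card ?D)) *
      ennreal (r ^ Suc k * indicator {S. \<forall>i\<le>k. S ! grid (k + 2) n (Suc i) = 2 * \<lfloor>y i * r\<rfloor>} S))"
    by (rule weighted) (use r0 in simp_all)
  finally show ?thesis unfolding kernel .
qed

lemma cell_prob_measurable:
  "(\<lambda>y. ennreal (r ^ Suc k * cell_prob k n y)) \<in> borel_measurable (\<Pi>\<^sub>M i\<in>{..k}. lborel)"
  unfolding cell_prob_kernel by measurable

text \<open>By Tonelli's theorem the product of the cell densities of one path has integral at most
  1. On \<open>A\<close> it vanishes unless the path lies in \<open>B\<close>, so only paths in
  \<open>B\<close> contribute.\<close>

lemma cell_prob_integral_le:
  assumes A: "A \<in> sets (\<Pi>\<^sub>M i\<in>{..k}. lborel)"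
    and AB: "\<And>y S. y \<in> A \<Longrightarrow> S \<in> dyck_paths (2 * n) \<Longrightarrow>
      (\<And>i. i \<le> k \<Longrightarrow> S ! grid (k + 2) n (Suc i) = 2 * \<lfloor>y i * r\<rfloor>) \<Longrightarrow> S \<in> B"
  shows "(\<integral>\<^sup>+ y. ennreal (r ^ Suc k * cell_prob k n y) * indicator A y \<partial>(\<Pi>\<^sub>M i\<in>{..k}. lborel))
           \<le> ennreal (dyck_prob n B)"
proof -
  have "product_sigma_finite (\<lambda>_ :: nat. lborel :: real measure)"
    by (rule product_sigma_finite.intro) (rule lborel.sigma_finite_measure_axioms)
  then have product: "(\<integral>\<^sup>+ y. (\<Prod>i\<le>k. cell_kernel S i (y i)) \<partial>(\<Pi>\<^sub>M i\<in>{..k}. lborel))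
      = (\<Prod>i\<le>k. \<integral>\<^sup>+ x. cell_kernel S i x \<partial>lborel)" for S
    by (rule product_sigma_finite.product_nn_integral_prod) simp_all
  let ?D = "dyck_paths (2 * n)" and ?P = "(\<Pi>\<^sub>M i\<in>{..k}. lborel) :: (nat \<Rightarrow> real) measure"
  let ?w = "ennreal (1 / real (card (dyck_paths (2 * n))))"
  have "(\<integral>\<^sup>+ y. ennreal (r ^ Suc k * cell_prob k n y) * indicator A y \<partial>?P)
      \<le> (\<integral>\<^sup>+ y. (\<Sum>S\<in>?D. ?w * indicator B S * (\<Prod>i\<le>k. cell_kernel S i (y i))) \<partial>?P)"
  proof (intro nn_integral_mono)
    fix y
    have "(\<Prod>i\<le>k. cell_kernel S i (y i)) * indicator A y \<le> indicator B S * (\<Prod>i\<le>k. cell_kernel S i (y i))"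
      if "S \<in> ?D" for S
    proof (cases "y \<in> A \<and> S \<notin> B")
      case True
      then have "\<exists>i\<le>k. S ! grid (k + 2) n (Suc i) \<noteq> 2 * \<lfloor>y i * r\<rfloor>"
        using AB[of y S, OF _ that] by (metis (no_types, lifting))
      then obtain i where "i \<le> k" "S ! grid (k + 2) n (Suc i) \<noteq> 2 * \<lfloor>y i * r\<rfloor>"
        by blast
      then have "(\<Prod>i\<le>k. cell_kernel S i (y i)) = 0"
        by (intro prod_zero bexI[of _ i]) (auto simp: cell_kernel_def)
      then show ?thesis by (simp only: mult_zero_left mult_zero_right order_refl)
    qed (auto simp: indicator_def)
    then show "ennreal (r ^ Suc k * cell_prob k n y) * indicator A y
        \<le> (\<Sum>S\<in>?D. ?w * indicator B S * (\<Prod>i\<le>k. cell_kernel S i (y i)))"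
      unfolding cell_prob_kernel sum_distrib_right mult.assoc
      by (intro sum_mono mult_left_mono) auto
  qed
  also have "\<dots> = (\<Sum>S\<in>?D. ?w * indicator B S * (\<Prod>i\<le>k. \<integral>\<^sup>+ x. cell_kernel S i x \<partial>lborel))"
    by (simp add: nn_integral_sum nn_integral_cmult product)
  also have "\<dots> \<le> (\<Sum>S\<in>?D. ?w * indicator B S)"
  proof (intro sum_mono)
    fix S
    have "(\<Prod>i\<le>k. \<integral>\<^sup>+ x. cell_kernel S i x \<partial>lborel) \<le> (\<Prod>i\<le>k. 1)"
      by (intro prod_mono_ennreal cell_kernel_integral)
    then show "?w * indicator B S * (\<Prod>i\<le>k. \<integral>\<^sup>+ x. cell_kernel S i x \<partial>lborel) \<le> ?w * indicator B S"
      using mult_left_mono[of "\<Prod>i\<le>k. \<integral>\<^sup>+ x. cell_kernel S i x \<partial>lborel" 1 "?w * indicator B S"] by simp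
  qed
  also have "\<dots> = ennreal (dyck_prob n B)"
    unfolding dyck_prob_eq_sum
    by (simp add: sum_divide_distrib ennreal_indicator[symmetric] flip: ennreal_mult sum_ennreal del: ennreal_indicator)
  finally show ?thesis .
qed

end

text \<open>The supremum is attained at a point \<open>s\<close>, and grid times converging to
  \<open>s\<close> bound the grid maxima from below.\<close>

lemma sup_grid_limit:
  assumes f: "continuous_on {0..1} (f :: real \<Rightarrow> real)"
  shows "(\<lambda>k. MAX i\<in>{..k}. f (grid_time k i)) \<longlonglongrightarrow> (SUP t\<in>{0..1}. f t)"
    and "\<And>t. t \<in> {0..1} \<Longrightarrow> f t \<le> (SUP t\<in>{0..1}. f t)"
proof -
  obtain s where s: "s \<in> {0..1}" "\<And>t. t \<in> {0..1} \<Longrightarrow> f t \<le> f s"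
    using continuous_attains_sup[OF compact_Icc _ f] by auto
  have sup: "(SUP t\<in>{0..1}. f t) = f s"
    using s by (intro cSup_eq_maximum) auto
  then show "f t \<le> (SUP t\<in>{0..1}. f t)" if "t \<in> {0..1}" for t using s that by simp
  have mem: "grid_time k i \<in> {0..1}" if "i \<le> k" for k i
    using that by simp
  \<comment> \<open>The times \<open>(i + 1) / (k + 2)\<close> with \<open>i \<le> k\<close> avoid
    both 0 and 1; the cap at \<open>k\<close> serves the case of \<open>s\<close> near 1.\<close>
  define i where "i k = min k (nat \<lfloor>s * real (k + 2)\<rfloor>)" for k
  have close: "\<bar>grid_time k (i k) - s\<bar> \<le> 2 / real (k + 2)" for k
  proof -
    have "\<bar>real (Suc (i k)) - s * real (k + 2)\<bar> \<le> 2"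
    proof -
      define u where "u = s * real (k + 2)"
      have "0 \<le> u" "u \<le> real (k + 2)"
        using s(1) mult_right_mono[of s 1 "real (k + 2)"] by (auto simp: u_def)
      then show ?thesis unfolding i_def u_def[symmetric]
        by (cases "k \<le> nat \<lfloor>u\<rfloor>") (simp_all add: min_def, linarith+)
    qed
    moreover have "grid_time k (i k) - s = (real (Suc (i k)) - s * real (k + 2)) / real (k + 2)"
      by (simp add: diff_divide_distrib)
    ultimately show ?thesis by (simp add: abs_divide divide_right_mono)
  qed
  have "(\<lambda>k. grid_time k (i k) - s) \<longlonglongrightarrow> 0"
    by (rule Lim_null_comparison[of _ "\<lambda>k. 2 / real (k + 2)"]) (use close in simp, real_asymp)
  then have "(\<lambda>k. grid_time k (i k)) \<longlonglongrightarrow> s" by (simp add: LIM_zero_iff)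
  then have lim: "(\<lambda>k. f (grid_time k (i k))) \<longlonglongrightarrow> f s"
  proof (rule continuous_on_tendsto_compose[OF f _ s(1)])
    show "\<forall>\<^sub>F k in sequentially. grid_time k (i k) \<in> {0..1}"
      by (intro always_eventually allI mem) (simp add: i_def)
  qed
  show "(\<lambda>k. MAX i\<in>{..k}. f (grid_time k i)) \<longlonglongrightarrow> (SUP t\<in>{0..1}. f t)"
    unfolding sup
  proof (rule tendsto_sandwich[OF _ _ lim tendsto_const])
    show "\<forall>\<^sub>F k in sequentially. f (grid_time k (i k)) \<le> (MAX i\<in>{..k}. f (grid_time k i))"
      by (intro always_eventually allI Max_ge) (auto simp: i_def)
    show "\<forall>\<^sub>F k in sequentially. (MAX i\<in>{..k}. f (grid_time k i)) \<le> f s"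
      using s(2) mem by (intro always_eventually allI Max.boundedI) auto
  qed
qed

text \<open>\<open>K\<close> and \<open>H\<close> are the levels \<open>x\<close> and
  \<open>x + \<epsilon>\<close> in units of \<open>sqrt (2 * n)\<close>, and a block has length
  about \<open>2 * n / m\<close>. Hence the exponents \<open>(H - K)^2 / L\<close> and
  \<open>(K + 1)^2 / L\<close> tend to \<open>\<epsilon>^2 * m\<close> and
  \<open>x^2 * m\<close>.\<close>

lemma overshoot_limit:
  assumes m: "0 < m" and x: "0 < x" and \<epsilon>: "0 < \<epsilon>"
  shows "(\<lambda>n. overshoot (2 * (n div m + 1)) (nat \<lfloor>x * sqrt (real (2 * n))\<rfloor>) (nat \<lfloor>(x + \<epsilon>) * sqrt (real (2 * n))\<rfloor>))
           \<longlonglongrightarrow> exp (- (\<epsilon>\<^sup>2 * real m)) / (1 - exp (- (x\<^sup>2 * real m)))"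
proof -
  let ?q = "\<lambda>n. sqrt (real (2 * n))"
  let ?K = "\<lambda>n. nat \<lfloor>x * ?q n\<rfloor>" and ?H = "\<lambda>n. nat \<lfloor>(x + \<epsilon>) * ?q n\<rfloor>" and ?L = "\<lambda>n. 2 * (n div m + 1)"
  have inv: "(\<lambda>n. 1 / ?q n) \<longlonglongrightarrow> 0" by real_asymp
  have fl: "(\<lambda>n. real (nat \<lfloor>y * ?q n\<rfloor>) / ?q n) \<longlonglongrightarrow> y" if "0 < y" for y
  proof -
    have "(\<lambda>n. y - 1 / ?q n) \<longlonglongrightarrow> y - 0" by (intro tendsto_diff tendsto_const inv)
    then have lo: "(\<lambda>n. y - 1 / ?q n) \<longlonglongrightarrow> y" by simp
    show ?thesis
    proof (rule tendsto_sandwich[OF _ _ lo tendsto_const])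
      show "\<forall>\<^sub>F n in sequentially. y - 1 / ?q n \<le> real (nat \<lfloor>y * ?q n\<rfloor>) / ?q n"
        using eventually_gt_at_top[of 0]
      proof eventually_elim
        case (elim n)
        have "(y * ?q n - 1) / ?q n \<le> real (nat \<lfloor>y * ?q n\<rfloor>) / ?q n"
          by (intro divide_right_mono) (linarith, simp)
        then show ?case using elim by (simp add: diff_divide_distrib)
      qed
      show "\<forall>\<^sub>F n in sequentially. real (nat \<lfloor>y * ?q n\<rfloor>) / ?q n \<le> y"
        using eventually_gt_at_top[of 0]
      proof eventually_elim
        case (elim n)
        have "real (nat \<lfloor>y * ?q n\<rfloor>) \<le> y * ?q n"
          using \<open>0 < y\<close> by (simp add: of_nat_nat)
        then have "real (nat \<lfloor>y * ?q n\<rfloor>) / ?q n \<le> (y * ?q n) / ?q n"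
          by (intro divide_right_mono) simp_all
        then show ?case using elim by simp
      qed
    qed
  qed
  have L: "(\<lambda>n. real (?L n) / real (2 * n)) \<longlonglongrightarrow> 1 / real m"
  proof -
    have "(\<lambda>n. real ((n * 1) div m) / real n + 1 / real n) \<longlonglongrightarrow> real 1 / real m + 0"
      by (intro tendsto_add grid_limit m) real_asymp
    moreover have "real ((n * 1) div m) / real n + 1 / real n = real (?L n) / real (2 * n)" for n
      by (cases "n = 0") (simp_all add: field_simps)
    ultimately show ?thesis by (simp only:) simp
  qed
  have "(\<lambda>n. exp (- (real (?H n) / ?q n - real (?K n) / ?q n)\<^sup>2 / (real (?L n) / real (2 * n)))
      / (1 - exp (- (real (?K n) / ?q n + 1 / ?q n)\<^sup>2 / (real (?L n) / real (2 * n)))))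
     \<longlonglongrightarrow> exp (- ((x + \<epsilon>) - x)\<^sup>2 / (1 / real m)) / (1 - exp (- (x + 0)\<^sup>2 / (1 / real m)))"
    by (intro tendsto_intros fl inv L) (use m x \<epsilon> in auto)
  moreover have "\<forall>\<^sub>F n in sequentially.
     exp (- (real (?H n) / ?q n - real (?K n) / ?q n)\<^sup>2 / (real (?L n) / real (2 * n)))
      / (1 - exp (- (real (?K n) / ?q n + 1 / ?q n)\<^sup>2 / (real (?L n) / real (2 * n))))
     = overshoot (?L n) (?K n) (?H n)"
    using eventually_gt_at_top[of 0]
  proof eventually_elim
    case (elim n)
    have "?K n \<le> ?H n" using \<epsilon> by (intro nat_mono floor_mono mult_right_mono) auto
    then have "real (?H n) / ?q n - real (?K n) / ?q n = real (?H n - ?K n) / ?q n"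
      by (simp add: of_nat_diff diff_divide_distrib)
    moreover have "real (?K n) / ?q n + 1 / ?q n = real (Suc (?K n)) / ?q n"
      by (simp add: add_divide_distrib)
    moreover have "(y / ?q n)\<^sup>2 / (real (?L n) / real (2 * n)) = y\<^sup>2 / real (?L n)" for y
      using elim by (simp add: power_divide)
    ultimately show ?case unfolding overshoot_def by (simp only: minus_divide_left[symmetric])
  qed
  ultimately show ?thesis
    by (simp add: Lim_transform_eventually)
qed

section \<open>Convergence of the law of the maximum\<close>

locale brownian_excursion = prob_space M for M :: "'a measure" +
  fixes e :: "real \<Rightarrow> 'a \<Rightarrow> real"
  assumes excursion: "normalized_brownian_excursion M e"
begin

section \<open>Measurability and sign of the supremum of the excursion\<close>

lemma e_measurable: "t \<in> {0..1} \<Longrightarrow> e t \<in> borel_measurable M"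
  using excursion by (simp add: normalized_brownian_excursion_def)

lemma e_continuous: "\<omega> \<in> space M \<Longrightarrow> continuous_on {0..1} (\<lambda>t. e t \<omega>)"
  using excursion by (simp add: normalized_brownian_excursion_def)

lemma e_distributed:
  assumes "0 < t 0" "\<And>i. i < k \<Longrightarrow> t i < t (Suc i)" "t k < 1"
  shows "distributed M (\<Pi>\<^sub>M i\<in>{..k}. lborel) (\<lambda>\<omega>. \<lambda>i\<in>{..k}. e (t i) \<omega>)
           (\<lambda>x. ennreal (excursion_density k t x))"
  using excursion assms by (simp add: normalized_brownian_excursion_def)

definition sup_e :: "'a \<Rightarrow> real" where
  "sup_e \<omega> = (SUP t\<in>{0..1}. e t \<omega>)"

definition max_grid :: "nat \<Rightarrow> 'a \<Rightarrow> real" where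
  "max_grid k \<omega> = (MAX i\<in>{..k}. e (grid_time k i) \<omega>)"

lemma max_grid_measurable [measurable]: "max_grid k \<in> borel_measurable M"
  unfolding max_grid_def[abs_def] by (intro borel_measurable_Max e_measurable) auto

lemma max_grid_limit: "\<omega> \<in> space M \<Longrightarrow> (\<lambda>k. max_grid k \<omega>) \<longlonglongrightarrow> sup_e \<omega>"
  unfolding max_grid_def sup_e_def by (rule sup_grid_limit(1)[OF e_continuous])

lemma sup_e_measurable [measurable]: "sup_e \<in> borel_measurable M"
  by (rule borel_measurable_LIMSEQ_real[OF max_grid_limit]) auto

lemma sup_e_upper: "\<omega> \<in> space M \<Longrightarrow> t \<in> {0..1} \<Longrightarrow> e t \<omega> \<le> sup_e \<omega>"
  unfolding sup_e_def by (rule sup_grid_limit(2)[OF e_continuous])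

lemma sup_e_nonneg: "AE \<omega> in M. 0 \<le> sup_e \<omega>"
proof -
  have "AE \<omega> in M. e 0 \<omega> = 0"
    using excursion by (auto simp: normalized_brownian_excursion_def)
  then show ?thesis
    by (rule AE_mp) (use sup_e_upper[of _ 0] in \<open>fastforce intro!: AE_I2\<close>)
qed

text \<open>Fatou's lemma for the step densities: a grid event \<open>A\<close> for the excursion
  forces the path event \<open>B n\<close> for large \<open>n\<close>. The bound is one-sided; upper
  bounds come from applying it to complements.\<close>

lemma grid_fatou:
  assumes A: "A \<in> sets (\<Pi>\<^sub>M i\<in>{..k}. lborel)"
    and AB: "\<forall>\<^sub>F n in sequentially. \<forall>y\<in>A. \<forall>S\<in>dyck_paths (2 * n).
      (\<forall>i\<le>k. S ! grid (k + 2) n (Suc i) = 2 * \<lfloor>y i * sqrt (real n / 2)\<rfloor>) \<longrightarrow> S \<in> B n"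
    and a: "a < prob {\<omega> \<in> space M. (\<lambda>i\<in>{..k}. e (grid_time k i) \<omega>) \<in> A}"
  shows "\<forall>\<^sub>F n in sequentially. a < dyck_prob n (B n)"
proof (cases "0 \<le> a")
  case True
  let ?P = "(\<Pi>\<^sub>M i\<in>{..k}. lborel) :: (nat \<Rightarrow> real) measure"
  let ?X = "\<lambda>\<omega>. \<lambda>i\<in>{..k}. e (grid_time k i) \<omega>"
  let ?f = "\<lambda>n y. ennreal (sqrt (real n / 2) ^ Suc k * cell_prob k n y)"
  have dist: "distributed M ?P ?X (\<lambda>y. ennreal (excursion_density k (grid_time k) y))"
    by (rule e_distributed) (auto simp: divide_strict_right_mono)
  have f_meas: "?f n \<in> borel_measurable ?P" for n
    using cell_prob_measurable[of n "sqrt (real n / 2)" k] by (cases "n = 0") auto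
  have "ennreal (prob {\<omega> \<in> space M. ?X \<omega> \<in> A}) = emeasure M (?X -` A \<inter> space M)"
    by (subst emeasure_eq_measure) (auto intro!: arg_cong[where f = prob])
  also have "\<dots> = (\<integral>\<^sup>+ y. ennreal (excursion_density k (grid_time k) y) * indicator A y \<partial>?P)"
    by (rule distributed_emeasure[OF dist A])
  also have "\<dots> \<le> (\<integral>\<^sup>+ y. liminf (\<lambda>n. ?f n y * indicator A y) \<partial>?P)"
  proof (intro nn_integral_mono)
    fix y
    show "ennreal (excursion_density k (grid_time k) y) * indicator A y \<le> liminf (\<lambda>n. ?f n y * indicator A y)"
    \<comment> \<open>\<open>cell_prob_limit\<close> needs positive coordinates; elsewhere the
      excursion density is 0 and the bound is trivial.\<close>
    proof (cases "y \<in> A \<and> (\<forall>i\<le>k. 0 < y i)")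
      case True
      then have "(\<lambda>n. ?f n y) \<longlonglongrightarrow> ennreal (excursion_density k (grid_time k) y)"
        by (intro tendsto_ennrealI cell_prob_limit) auto
      then have "liminf (\<lambda>n. ?f n y) = ennreal (excursion_density k (grid_time k) y)"
        by (intro lim_imp_Liminf) auto
      then show ?thesis using True by simp
    next
      case False
      then have "ennreal (excursion_density k (grid_time k) y) * indicator A y = 0"
        by (auto simp: excursion_density_def)
      then show ?thesis by (simp only: zero_le)
    qed
  qed
  also have "\<dots> \<le> liminf (\<lambda>n. \<integral>\<^sup>+ y. ?f n y * indicator A y \<partial>?P)"
    using f_meas A by (intro nn_integral_liminf borel_measurable_times_ennreal borel_measurable_indicator)
  also have "\<dots> \<le> liminf (\<lambda>n. ennreal (dyck_prob n (B n)))"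
  proof (rule Liminf_mono)
    show "\<forall>\<^sub>F n in sequentially. (\<integral>\<^sup>+ y. ?f n y * indicator A y \<partial>?P) \<le> ennreal (dyck_prob n (B n))"
      using AB eventually_gt_at_top[of 0]
    proof eventually_elim
      case (elim n)
      show ?case
        by (rule cell_prob_integral_le[OF elim(2) refl A]) (use elim(1) in auto)
    qed
  qed
  finally have "ennreal (prob {\<omega> \<in> space M. ?X \<omega> \<in> A}) \<le> liminf (\<lambda>n. ennreal (dyck_prob n (B n)))" .
  moreover have "ennreal a < ennreal (prob {\<omega> \<in> space M. ?X \<omega> \<in> A})"
    using a True by (simp only: ennreal_less_iff)
  ultimately have "\<forall>\<^sub>F n in sequentially. ennreal a < ennreal (dyck_prob n (B n))"
    unfolding le_Liminf_iff by blast
  then show ?thesis using True by (simp add: ennreal_less_iff)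
next
  case False
  then have "a < dyck_prob n (B n)" for n
    using measure_nonneg[of "measure_pmf (dyck_pmf n)" "B n"] by linarith
  then show ?thesis by simp
qed

text \<open>Grid maxima converge to the supremum, so with probability above \<open>a\<close> some
  fixed grid exceeds \<open>x\<close> by a margin \<open>1 / (k + 1)\<close>. In path units this
  margin grows like \<open>sqrt n\<close> and absorbs the rounding of heights, which is less than
  2.\<close>

lemma max_exceeds_liminf:
  assumes a: "a < prob {\<omega> \<in> space M. x < sup_e \<omega>}"
  shows "\<forall>\<^sub>F n in sequentially. a < dyck_prob n {S. x * sqrt (real (2 * n)) < path_max S}"
proof -
  \<comment> \<open>Asking for the inequality at all \<open>k \<ge> K\<close> makes these events
    increase with \<open>K\<close>, so that their probabilities converge to that of the
    union.\<close>
  let ?E = "\<lambda>K. {\<omega> \<in> space M. \<forall>k\<ge>K. x + 1 / real (Suc k) < max_grid k \<omega>}"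
  have E: "?E K \<in> events" for K by measurable
  have "{\<omega> \<in> space M. x < sup_e \<omega>} \<subseteq> (\<Union>K. ?E K)"
  proof
    fix \<omega> assume "\<omega> \<in> {\<omega> \<in> space M. x < sup_e \<omega>}"
    then have \<omega>: "\<omega> \<in> space M" "x < sup_e \<omega>" by auto
    have "(\<lambda>k. max_grid k \<omega> - 1 / real (Suc k)) \<longlonglongrightarrow> sup_e \<omega> - 0"
      by (intro tendsto_diff max_grid_limit \<omega>) real_asymp
    then have "\<forall>\<^sub>F k in sequentially. x < max_grid k \<omega> - 1 / real (Suc k)"
      using \<omega> by (intro order_tendstoD) auto
    then show "\<omega> \<in> (\<Union>K. ?E K)"
      using \<omega> by (auto simp: eventually_sequentially less_diff_eq)
  qed
  moreover have "(\<Union>K. ?E K) \<in> events" using E by blast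
  ultimately have "prob {\<omega> \<in> space M. x < sup_e \<omega>} \<le> prob (\<Union>K. ?E K)"
    by (rule finite_measure_mono)
  moreover have "(\<lambda>K. prob (?E K)) \<longlonglongrightarrow> prob (\<Union>K. ?E K)"
    using E by (intro finite_Lim_measure_incseq) (auto simp: incseq_def)
  moreover note a
  ultimately have "\<forall>\<^sub>F K in sequentially. a < prob (?E K)"
    by (intro order_tendstoD(1)[of _ "prob (\<Union>K. ?E K)"]) linarith+
  then obtain k where k: "a < prob (?E k)"
    by (auto dest: eventually_happens)
  define x' where "x' = x + 1 / real (Suc k)"
  let ?A = "{y \<in> space (\<Pi>\<^sub>M i\<in>{..k}. lborel). \<exists>i\<in>{..k}. x' < y i}"
  note k
  also have "prob (?E k) \<le> prob {\<omega> \<in> space M. (\<lambda>i\<in>{..k}. e (grid_time k i) \<omega>) \<in> ?A}"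
  proof (rule finite_measure_mono)
    show "?E k \<subseteq> {\<omega> \<in> space M. (\<lambda>i\<in>{..k}. e (grid_time k i) \<omega>) \<in> ?A}"
    proof
      fix \<omega> assume "\<omega> \<in> ?E k"
      then have "\<omega> \<in> space M" "x' < max_grid k \<omega>" by (auto simp: x'_def)
      then show "\<omega> \<in> {\<omega> \<in> space M. (\<lambda>i\<in>{..k}. e (grid_time k i) \<omega>) \<in> ?A}"
        unfolding max_grid_def by (subst (asm) Max_gr_iff) (auto simp: space_PiM)
    qed
    have [measurable]: "e (grid_time k i) \<in> borel_measurable M" if "i \<le> k" for i
      using that by (intro e_measurable) simp
    have "{\<omega> \<in> space M. (\<lambda>i\<in>{..k}. e (grid_time k i) \<omega>) \<in> ?A} = {\<omega> \<in> space M. \<exists>i\<in>{..k}. x' < e (grid_time k i) \<omega>}"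
      by (auto simp: space_PiM)
    also have "\<dots> \<in> events" by measurable
    finally show "{\<omega> \<in> space M. (\<lambda>i\<in>{..k}. e (grid_time k i) \<omega>) \<in> ?A} \<in> events" .
  qed
  finally have "a < prob {\<omega> \<in> space M. (\<lambda>i\<in>{..k}. e (grid_time k i) \<omega>) \<in> ?A}" .
  moreover have "?A \<in> sets (\<Pi>\<^sub>M i\<in>{..k}. lborel)" by measurable
  moreover have "\<forall>\<^sub>F n in sequentially. \<forall>y\<in>?A. \<forall>S\<in>dyck_paths (2 * n).
      (\<forall>i\<le>k. S ! grid (k + 2) n (Suc i) = 2 * \<lfloor>y i * sqrt (real n / 2)\<rfloor>) \<longrightarrow>
        S \<in> {S. x * sqrt (real (2 * n)) < path_max S}"
  proof -
    have "filterlim (\<lambda>n. 1 / real (Suc k) * sqrt (real (2 * n))) at_top sequentially"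
      by (rule filterlim_tendsto_pos_mult_at_top[OF tendsto_const]) (simp, real_asymp)
    then have "\<forall>\<^sub>F n in sequentially. 2 \<le> 1 / real (Suc k) * sqrt (real (2 * n))"
      by (simp add: filterlim_at_top)
    then show ?thesis
    proof (eventually_elim, intro ballI impI)
      fix n y S
      assume n: "2 \<le> 1 / real (Suc k) * sqrt (real (2 * n))" and "y \<in> ?A" and S: "S \<in> dyck_paths (2 * n)"
        and eq: "\<forall>i\<le>k. S ! grid (k + 2) n (Suc i) = 2 * \<lfloor>y i * sqrt (real n / 2)\<rfloor>"
      then obtain i where i: "i \<le> k" "x' < y i" by auto
      have q: "2 * sqrt (real n / 2) = sqrt (real (2 * n))"
        by (rule real_sqrt_unique[symmetric]) (simp_all add: power_mult_distrib)
      have "x * sqrt (real (2 * n)) + 2 \<le> x' * sqrt (real (2 * n))"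
        using n by (simp add: x'_def distrib_right)
      also have "\<dots> \<le> y i * sqrt (real (2 * n))"
        using i by (intro mult_right_mono) auto
      also have "\<dots> = 2 * (y i * sqrt (real n / 2))" by (simp only: q[symmetric])
      also have "\<dots> < 2 * real_of_int \<lfloor>y i * sqrt (real n / 2)\<rfloor> + 2" by linarith
      also have "2 * real_of_int \<lfloor>y i * sqrt (real n / 2)\<rfloor> = real_of_int (S ! grid (k + 2) n (Suc i))"
        using eq i by simp
      also have "\<dots> \<le> real_of_int (path_max S)"
      proof -
        have "(n * Suc i) div (k + 2) \<le> (n * (k + 2)) div (k + 2)"
          using i by (intro div_le_mono mult_le_mono) auto
        also have "\<dots> = n" by (rule nonzero_mult_div_cancel_right) simp
        finally show ?thesis using path_max_nth[OF S, of "grid (k + 2) n (Suc i)"] by simp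
      qed
      finally show "S \<in> {S. x * sqrt (real (2 * n)) < path_max S}" by simp
    qed
  qed
  ultimately show ?thesis by (intro grid_fatou[where k = k and A = ?A])
qed

text \<open>First \<open>m\<close> is fixed, then \<open>n\<close> grows: \<open>grid_fatou\<close>
  controls the values on a grid of \<open>m\<close> blocks, and \<open>dyck_prob_grid\<close> passes
  to the whole path at the price of a factor whose limit in \<open>n\<close> is close to 1 for large
  \<open>m\<close>.\<close>

lemma max_below_liminf:
  assumes a: "a < prob {\<omega> \<in> space M. sup_e \<omega> \<le> x}" and x: "0 < x" and \<epsilon>: "0 < \<epsilon>"
  shows "\<forall>\<^sub>F n in sequentially. a < dyck_prob n {S. path_max S < (x + \<epsilon>) * sqrt (real (2 * n))}"
proof -
  let ?p = "prob {\<omega> \<in> space M. sup_e \<omega> \<le> x}"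
  \<comment> \<open>The limit of the overshoot as \<open>n\<close> grows with \<open>m\<close>
    fixed; it decays exponentially in \<open>m\<close>, so that \<open>m * o' m\<close> still tends
    to 0.\<close>
  define o' where "o' m = exp (- (\<epsilon>\<^sup>2 * real m)) / (1 - exp (- (x\<^sup>2 * real m)))" for m
  have o_lim: "(\<lambda>m. 1 - real m * o' m) \<longlonglongrightarrow> 1 - 0"
    unfolding o'_def using x \<epsilon> by (intro tendsto_diff tendsto_const) real_asymp
  have "(\<lambda>m. (1 - real m * o' m) * ?p) \<longlonglongrightarrow> (1 - 0) * ?p"
    by (intro tendsto_mult o_lim tendsto_const)
  then have "\<forall>\<^sub>F m in sequentially. a < (1 - real m * o' m) * ?p"
    using a by (intro order_tendstoD) auto
  moreover have "\<forall>\<^sub>F m in sequentially. 0 < 1 - real m * o' m"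
    using o_lim by (intro order_tendstoD) auto
  moreover have "\<forall>\<^sub>F m in sequentially. 2 \<le> (m :: nat)" by (rule eventually_ge_at_top)
  ultimately have "\<forall>\<^sub>F m in sequentially. a < (1 - real m * o' m) * ?p \<and> 0 < 1 - real m * o' m \<and> 2 \<le> m"
    by eventually_elim auto
  then obtain m where m: "a < (1 - real m * o' m) * ?p" "0 < 1 - real m * o' m" "2 \<le> m"
    by (auto dest: eventually_happens)
  define k where "k = m - 2"
  have mk: "m = k + 2" using m by (simp add: k_def)
  have o0: "0 \<le> o' m" unfolding o'_def by simp
  have "1 * o' m \<le> real m * o' m" using m o0 by (intro mult_right_mono) auto
  then have o1: "o' m < 1" using m by linarith
  have "1 - real m * o' m \<le> (1 - o' m) ^ m"
    using Bernoulli_inequality[of "- o' m" m] o1 by simp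
  then have "(1 - real m * o' m) * ?p \<le> (1 - o' m) ^ m * ?p"
    by (intro mult_right_mono) auto
  with m have am: "a < (1 - o' m) ^ m * ?p" by linarith
  \<comment> \<open>\<open>grid_fatou\<close> gives only lower bounds strictly below the limit
    probability; \<open>b\<close> leaves room for this.\<close>
  have "\<exists>b<?p. a < (1 - o' m) ^ m * b"
  proof -
    define q where "q = (1 - o' m) ^ m"
    have q: "0 < q" using o1 by (simp add: q_def)
    have "a / q < ?p" using am q by (simp add: q_def[symmetric] divide_less_eq mult.commute)
    then obtain b where "a / q < b" "b < ?p" using dense by blast
    then show ?thesis using q by (auto simp: q_def[symmetric] divide_less_eq mult.commute intro!: exI[of _ b])
  qed
  then obtain b where b: "b < ?p" "a < (1 - o' m) ^ m * b" by blast
  let ?A = "{y \<in> space (\<Pi>\<^sub>M i\<in>{..k}. lborel). \<forall>i\<in>{..k}. y i \<le> x}"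
  have "?p \<le> prob {\<omega> \<in> space M. (\<lambda>i\<in>{..k}. e (grid_time k i) \<omega>) \<in> ?A}"
  proof (rule finite_measure_mono)
    show "{\<omega> \<in> space M. sup_e \<omega> \<le> x} \<subseteq> {\<omega> \<in> space M. (\<lambda>i\<in>{..k}. e (grid_time k i) \<omega>) \<in> ?A}"
      using order_trans[OF sup_e_upper] by (auto simp: space_PiM)
    have [measurable]: "e (grid_time k i) \<in> borel_measurable M" if "i \<le> k" for i
      using that by (intro e_measurable) simp
    have "{\<omega> \<in> space M. (\<lambda>i\<in>{..k}. e (grid_time k i) \<omega>) \<in> ?A} = {\<omega> \<in> space M. \<forall>i\<in>{..k}. e (grid_time k i) \<omega> \<le> x}"
      by (auto simp: space_PiM)
    also have "\<dots> \<in> events" by measurable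
    finally show "{\<omega> \<in> space M. (\<lambda>i\<in>{..k}. e (grid_time k i) \<omega>) \<in> ?A} \<in> events" .
  qed
  with b have "b < prob {\<omega> \<in> space M. (\<lambda>i\<in>{..k}. e (grid_time k i) \<omega>) \<in> ?A}" by linarith
  moreover have "?A \<in> sets (\<Pi>\<^sub>M i\<in>{..k}. lborel)" by measurable
  moreover have "S ! grid m n j \<le> int (nat \<lfloor>x * sqrt (real (2 * n))\<rfloor>)"
    if "y \<in> ?A" and S: "S \<in> dyck_paths (2 * n)" and "j \<le> m"
      and eq: "\<And>i. i \<le> k \<Longrightarrow> S ! grid (k + 2) n (Suc i) = 2 * \<lfloor>y i * sqrt (real n / 2)\<rfloor>" for n y S j
  proof -
    \<comment> \<open>The blocks of \<open>dyck_prob_grid\<close> also have the endpoints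
      \<open>j = 0\<close> and \<open>j = m\<close>, where the path is 0; \<open>y\<close> covers
      the interior times.\<close>
    consider "j = 0" | "j = m" | i where "j = Suc i" "i \<le> k"
      using \<open>j \<le> m\<close> mk by (cases j) force+
    then show ?thesis
    proof cases
      case 3
      have q: "2 * sqrt (real n / 2) = sqrt (real (2 * n))"
        by (rule real_sqrt_unique[symmetric]) (simp_all add: power_mult_distrib)
      have "real_of_int (S ! grid m n j) = 2 * real_of_int \<lfloor>y i * sqrt (real n / 2)\<rfloor>"
        using eq 3 mk by simp
      also have "\<dots> \<le> 2 * (y i * sqrt (real n / 2))" by linarith
      also have "\<dots> = y i * sqrt (real (2 * n))" by (simp only: q[symmetric])
      also have "\<dots> \<le> x * sqrt (real (2 * n))"
        using \<open>y \<in> ?A\<close> 3 by (intro mult_right_mono) auto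
      finally show ?thesis by (simp add: le_floor_iff)
    qed (use dyck_pathD[OF S] m in simp_all)
  qed
  then have "\<forall>\<^sub>F n in sequentially. \<forall>y\<in>?A. \<forall>S\<in>dyck_paths (2 * n).
      (\<forall>i\<le>k. S ! grid (k + 2) n (Suc i) = 2 * \<lfloor>y i * sqrt (real n / 2)\<rfloor>) \<longrightarrow>
        S \<in> {S. \<forall>j\<le>m. S ! grid m n j \<le> int (nat \<lfloor>x * sqrt (real (2 * n))\<rfloor>)}"
    by (intro always_eventually) auto
  ultimately have grid: "\<forall>\<^sub>F n in sequentially.
      b < dyck_prob n {S. \<forall>j\<le>m. S ! grid m n j \<le> int (nat \<lfloor>x * sqrt (real (2 * n))\<rfloor>)}"
    by (intro grid_fatou[where k = k and A = ?A])
  let ?K = "\<lambda>n. nat \<lfloor>x * sqrt (real (2 * n))\<rfloor>" and ?H = "\<lambda>n. nat \<lfloor>(x + \<epsilon>) * sqrt (real (2 * n))\<rfloor>"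
  let ?o = "\<lambda>n. overshoot (2 * (n div m + 1)) (?K n) (?H n)"
  have olim: "?o \<longlonglongrightarrow> o' m"
    unfolding o'_def using overshoot_limit[of m x \<epsilon>] m x \<epsilon> by simp
  then have "\<forall>\<^sub>F n in sequentially. ?o n < 1"
    using o1 by (rule order_tendstoD)
  moreover have "(\<lambda>n. (1 - ?o n) ^ m * b) \<longlonglongrightarrow> (1 - o' m) ^ m * b"
    by (intro tendsto_intros olim)
  then have "\<forall>\<^sub>F n in sequentially. a < (1 - ?o n) ^ m * b"
    using b by (intro order_tendstoD) auto
  moreover have "filterlim (\<lambda>n. \<epsilon> * sqrt (real (2 * n))) at_top sequentially"
    using \<epsilon> by (intro filterlim_tendsto_pos_mult_at_top[OF tendsto_const]) (simp, real_asymp)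
  then have "\<forall>\<^sub>F n in sequentially. 1 \<le> \<epsilon> * sqrt (real (2 * n))"
    by (simp add: filterlim_at_top)
  ultimately show ?thesis
    using grid
  proof eventually_elim
    case (elim n)
    have KH: "?K n < ?H n"
    proof -
      have "x * sqrt (real (2 * n)) + 1 \<le> (x + \<epsilon>) * sqrt (real (2 * n))"
        using elim by (simp add: distrib_right)
      then have "\<lfloor>x * sqrt (real (2 * n))\<rfloor> < \<lfloor>(x + \<epsilon>) * sqrt (real (2 * n))\<rfloor>" by linarith
      moreover have "0 \<le> \<lfloor>x * sqrt (real (2 * n))\<rfloor>" using x by simp
      ultimately show ?thesis by linarith
    qed
    note \<open>a < (1 - ?o n) ^ m * b\<close>
    also have "(1 - ?o n) ^ m * b \<le> (1 - ?o n) ^ m * dyck_prob n {S. \<forall>j\<le>m. S ! grid m n j \<le> int (?K n)}"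
      using elim by (intro mult_left_mono) auto
    also have "\<dots> \<le> dyck_prob n {S. path_max S < int (?H n)}"
    proof (rule dyck_prob_grid[where s = "grid m n"])
      show "grid m n (Suc j) - grid m n j \<le> 2 * (n div m + 1)" for j
        using m by (intro grid_step_le) auto
      show "grid m n j \<le> grid m n (Suc j)" for j
        by (simp add: div_le_mono)
    qed (use KH elim m in auto)
    also have "\<dots> \<le> dyck_prob n {S. path_max S < (x + \<epsilon>) * sqrt (real (2 * n))}"
    proof (rule dyck_prob_mono)
      fix S assume "S \<in> {S. path_max S < int (?H n)}"
      then have "path_max S < \<lfloor>(x + \<epsilon>) * sqrt (real (2 * n))\<rfloor>"
        using x \<epsilon> by simp
      then show "S \<in> {S. path_max S < (x + \<epsilon>) * sqrt (real (2 * n))}"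
        by (simp add: less_floor_iff)
    qed
    finally show ?case .
  qed
qed

text \<open>For the upper bound, continuity gives a level \<open>y < x\<close> whose tail is still
  below \<open>a\<close>, and \<open>max_below_liminf\<close> applies at \<open>y\<close> with
  \<open>\<epsilon> = x - y\<close>.\<close>

lemma max_exceeds_limit:
  assumes cont: "isCont (\<lambda>x. prob {\<omega> \<in> space M. x < sup_e \<omega>}) x" and x: "0 < x"
  shows "(\<lambda>n. dyck_prob n {S. x * sqrt (real (2 * n)) < path_max S}) \<longlonglongrightarrow> prob {\<omega> \<in> space M. x < sup_e \<omega>}"
proof (rule order_tendstoI)
  fix a assume "a < prob {\<omega> \<in> space M. x < sup_e \<omega>}"
  then show "\<forall>\<^sub>F n in sequentially. a < dyck_prob n {S. x * sqrt (real (2 * n)) < path_max S}"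
    by (rule max_exceeds_liminf)
next
  fix a assume a: "prob {\<omega> \<in> space M. x < sup_e \<omega>} < a"
  have "\<forall>\<^sub>F y in at x. prob {\<omega> \<in> space M. y < sup_e \<omega>} < a"
    using cont a unfolding isCont_def by (rule order_tendstoD)
  then have "\<forall>\<^sub>F y in at_left x. prob {\<omega> \<in> space M. y < sup_e \<omega>} < a"
    by (rule filter_leD[OF at_le, rotated]) simp
  moreover have "\<forall>\<^sub>F y in at_left x. y \<in> {0<..<x}"
    using x by (rule eventually_at_leftI[of 0 x, rotated]) simp
  ultimately have "\<forall>\<^sub>F y in at_left x. prob {\<omega> \<in> space M. y < sup_e \<omega>} < a \<and> y \<in> {0<..<x}"
    by eventually_elim auto
  then obtain y where y: "prob {\<omega> \<in> space M. y < sup_e \<omega>} < a" "0 < y" "y < x"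
    by (auto dest: eventually_happens simp: trivial_limit_at_left_real)
  have compl: "prob {\<omega> \<in> space M. sup_e \<omega> \<le> y} = 1 - prob {\<omega> \<in> space M. y < sup_e \<omega>}"
    by (subst prob_compl[symmetric]) (auto intro!: arg_cong[where f = prob])
  have "\<forall>\<^sub>F n in sequentially. 1 - a < dyck_prob n {S. path_max S < (y + (x - y)) * sqrt (real (2 * n))}"
    using y compl by (intro max_below_liminf) auto
  then show "\<forall>\<^sub>F n in sequentially. dyck_prob n {S. x * sqrt (real (2 * n)) < path_max S} < a"
  proof eventually_elim
    case (elim n)
    have "dyck_prob n {S. x * sqrt (real (2 * n)) < path_max S} \<le> dyck_prob n (space (measure_pmf (dyck_pmf n)) - {S. path_max S < x * sqrt (real (2 * n))})"
      by (rule dyck_prob_mono) auto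
    also have "\<dots> = 1 - dyck_prob n {S. path_max S < x * sqrt (real (2 * n))}"
      by (rule measure_pmf.prob_compl) simp
    also have "\<dots> < a" using elim by simp
    finally show ?case .
  qed
qed

end

section \<open>Exponential moments\<close>

text \<open>For \<open>y \<ge> 0\<close>, \<open>exp (c * y)\<close> is 1 plus the integral of
  \<open>c * exp (c * x)\<close> over \<open>0 < x < y\<close>; Tonelli's theorem then exchanges the
  two integrals.\<close>

lemma (in prob_space) exp_layer_cake:
  assumes X [measurable]: "X \<in> borel_measurable M" and nonneg: "AE \<omega> in M. 0 \<le> X \<omega>" and c: "0 < c"
  shows "(\<integral>\<^sup>+ \<omega>. ennreal (exp (c * X \<omega>)) \<partial>M) =
    1 + (\<integral>\<^sup>+ x. ennreal (c * exp (c * x)) * indicator {0<..} x * ennreal (prob {\<omega> \<in> space M. x < X \<omega>}) \<partial>lborel)"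
proof -
  interpret pair_sigma_finite M lborel
    by (rule pair_sigma_finite.intro) (rule sigma_finite_measure_axioms, rule lborel.sigma_finite_measure_axioms)
  let ?f = "\<lambda>x. ennreal (c * exp (c * x)) * indicator {0<..} x"
  have "ennreal (exp (c * y)) = 1 + (\<integral>\<^sup>+ x. ?f x * indicator {x. x < y} x \<partial>lborel)" if "0 \<le> y" for y
  proof -
    have "(\<integral>\<^sup>+ x. ?f x * indicator {x. x < y} x \<partial>lborel)
        = (\<integral>\<^sup>+ x. ennreal (c * exp (c * x)) * indicator {0..y} x \<partial>lborel)"
    proof (rule nn_integral_cong_AE)
      have "AE x in lborel. x \<noteq> 0 \<and> x \<noteq> y"
        using AE_lborel_singleton[of 0] AE_lborel_singleton[of y] by eventually_elim simp
      then show "AE x in lborel. ?f x * indicator {x. x < y} x = ennreal (c * exp (c * x)) * indicator {0..y} x"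
        by eventually_elim (auto simp: indicator_def)
    qed
    also have "\<dots> = ennreal (exp (c * y) - exp (c * 0))"
      using that c by (intro nn_integral_FTC_Icc) (auto intro!: derivative_eq_intros)
    finally show ?thesis
      using that c by (simp flip: ennreal_plus ennreal_1)
  qed
  then have "(\<integral>\<^sup>+ \<omega>. ennreal (exp (c * X \<omega>)) \<partial>M)
      = (\<integral>\<^sup>+ \<omega>. 1 + (\<integral>\<^sup>+ x. ?f x * indicator {x. x < X \<omega>} x \<partial>lborel) \<partial>M)"
    using nonneg by (intro nn_integral_cong_AE) (auto elim!: eventually_mono)
  also have "\<dots> = 1 + (\<integral>\<^sup>+ \<omega>. (\<integral>\<^sup>+ x. ?f x * indicator {x. x < X \<omega>} x \<partial>lborel) \<partial>M)"
    by (subst nn_integral_add) (auto simp: emeasure_space_1 indicator_def)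
  also have "(\<integral>\<^sup>+ \<omega>. (\<integral>\<^sup>+ x. ?f x * indicator {x. x < X \<omega>} x \<partial>lborel) \<partial>M)
     = (\<integral>\<^sup>+ x. (\<integral>\<^sup>+ \<omega>. ?f x * indicator {x. x < X \<omega>} x \<partial>M) \<partial>lborel)"
    by (rule Fubini'[symmetric]) (simp add: indicator_def)
  also have "\<dots> = (\<integral>\<^sup>+ x. ?f x * ennreal (prob {\<omega> \<in> space M. x < X \<omega>}) \<partial>lborel)"
  proof (intro nn_integral_cong)
    fix x
    have "(\<integral>\<^sup>+ \<omega>. ?f x * indicator {x. x < X \<omega>} x \<partial>M) = (\<integral>\<^sup>+ \<omega>. ?f x * indicator {\<omega> \<in> space M. x < X \<omega>} \<omega> \<partial>M)"
      by (intro nn_integral_cong) (auto simp: indicator_def)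
    also have "\<dots> = ?f x * emeasure M {\<omega> \<in> space M. x < X \<omega>}"
      by (rule nn_integral_cmult_indicator) measurable
    finally show "(\<integral>\<^sup>+ \<omega>. ?f x * indicator {x. x < X \<omega>} x \<partial>M) = ?f x * ennreal (prob {\<omega> \<in> space M. x < X \<omega>})"
      by (simp add: emeasure_eq_measure)
  qed
  finally show ?thesis .
qed

text \<open>With \<open>K\<close> at level 1 and \<open>H\<close> at level \<open>x\<close> in units
  of \<open>sqrt (2 * n)\<close>, \<open>dyck_max_tail\<close> gives
  \<open>2 * exp (- (x - 1)^2)\<close>, as the denominator of the overshoot is at least 1/2. For
  \<open>x < 2\<close> the claimed bound is at least 1.\<close>

lemma dyck_max_exp_tail:
  assumes n: "0 < n" and x: "0 \<le> x" and a: "0 < a"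
  shows "dyck_prob n {S. x * sqrt (real (2 * n)) < path_max S} \<le> 2 * exp (2 * a + a\<^sup>2 / 4) * exp (- a * x)"
proof (cases "x < 2")
  case True
  have "a * x \<le> a * 2" "0 \<le> a\<^sup>2 / 4"
    using True a by (auto intro: mult_left_mono)
  then have "a * x \<le> 2 * a + a\<^sup>2 / 4" by linarith
  then have "1 \<le> exp (2 * a + a\<^sup>2 / 4 + (- a * x))" by simp
  then have "1 \<le> 2 * exp (2 * a + a\<^sup>2 / 4 + (- a * x))" by linarith
  then have "1 \<le> 2 * exp (2 * a + a\<^sup>2 / 4) * exp (- a * x)" by (simp only: exp_add mult.assoc)
  then show ?thesis by (rule order_trans[OF measure_pmf.prob_le_1])
next
  case False
  define q where "q = sqrt (real (2 * n))"
  have q: "0 < q" "q\<^sup>2 = real (2 * n)" using n by (simp_all add: q_def)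
  define K where "K = nat \<lfloor>q\<rfloor>"
  define H where "H = nat \<lceil>x * q\<rceil>"
  have K: "real K \<le> q" "q \<le> real (Suc K)" using q by (simp_all add: K_def of_nat_nat) linarith
  have H: "x * q \<le> real H" unfolding H_def by (rule of_nat_ceiling)
  have "2 * q \<le> x * q" using False q by (intro mult_right_mono) auto
  then have "real K < real H" using K H q by linarith
  then have KH: "K < H" by simp
  have HK: "(x - 1) * q \<le> real (H - K)"
    using K H KH by (simp add: of_nat_diff left_diff_distrib)
  have "dyck_prob n {S. x * q < path_max S} \<le> dyck_prob n {S. int H \<le> path_max S}"
  proof (rule dyck_prob_mono)
    fix S assume "S \<in> dyck_paths (2 * n)" "S \<in> {S. x * q < path_max S}"
    then have "x * q \<le> path_max S" by simp
    then have "\<lceil>x * q\<rceil> \<le> path_max S" by (simp add: ceiling_le_iff)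
    moreover have "0 \<le> \<lceil>x * q\<rceil>" using x q by (simp add: ceiling_mono[of 0, simplified])
    ultimately show "S \<in> {S. int H \<le> path_max S}" by (simp add: H_def)
  qed
  also have "\<dots> \<le> overshoot (2 * n) K H"
    by (rule dyck_max_tail[OF KH n])
  also have "\<dots> \<le> exp (- (x - 1)\<^sup>2) / (1 / 2)"
    unfolding overshoot_def
  proof (intro frac_le)
    have "(x - 1)\<^sup>2 = ((x - 1) * q)\<^sup>2 / real (2 * n)"
      using q n by (simp add: power_mult_distrib)
    also have "\<dots> \<le> (real (H - K))\<^sup>2 / real (2 * n)"
      using HK False q by (intro divide_right_mono power_mono) auto
    finally show "exp (- (real (H - K))\<^sup>2 / real (2 * n)) \<le> exp (- (x - 1)\<^sup>2)" by simp
    have "q\<^sup>2 \<le> (real (Suc K))\<^sup>2" using K q by (intro power_mono) auto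
    then have "exp (- (real (Suc K))\<^sup>2 / real (2 * n)) \<le> exp (- 1)"
      using n unfolding q(2) by (simp add: le_divide_eq)
    moreover have "2 \<le> exp (1 :: real)" using exp_ge_add_one_self[of 1] by simp
    then have "exp (- 1 :: real) \<le> 1 / 2" by (simp add: exp_minus field_simps)
    ultimately show "1 / 2 \<le> 1 - exp (- (real (Suc K))\<^sup>2 / real (2 * n))" by linarith
  qed auto
  also have "\<dots> \<le> 2 * exp (2 * a + a\<^sup>2 / 4 + (- a * x))"
  proof -
    \<comment> \<open>Completing the square trades the Gaussian for decay at rate \<open>a\<close>,
      with constant \<open>a + a^2 / 4\<close>; this is enlarged to \<open>2 * a + a^2 / 4\<close>,
      the constant that suits \<open>x < 2\<close>.\<close>
    have "0 \<le> (x - 1 - a / 2)\<^sup>2" by simp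
    also have "\<dots> = (x - 1)\<^sup>2 - a * x + a + a\<^sup>2 / 4"
      by (simp add: power2_eq_square algebra_simps)
    finally have "- (x - 1)\<^sup>2 \<le> 2 * a + a\<^sup>2 / 4 + (- a * x)" using a by simp
    then show ?thesis by simp
  qed
  also have "\<dots> = 2 * exp (2 * a + a\<^sup>2 / 4) * exp (- a * x)"
    by (subst exp_add) (rule mult.assoc[symmetric])
  finally show ?thesis unfolding q_def .
qed

section \<open>A majorant of the layer-cake integrands, uniform in \<open>n\<close>\<close>

lemma borel_measurable_antimono:
  fixes f :: "real \<Rightarrow> real"
  assumes "antimono f"
  shows "f \<in> borel_measurable borel"
proof -
  have "mono (\<lambda>x. - f x)" using assms by (auto simp: monotone_def)
  then have "(\<lambda>x. - (- f x)) \<in> borel_measurable borel"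
    by (intro borel_measurable_uminus borel_measurable_mono)
  then show ?thesis by simp
qed

lemma exp_integral_1: "(\<integral>\<^sup>+ x. ennreal (exp (- x)) * indicator {0..} x \<partial>lborel) = 1"
proof -
  have "(\<integral>\<^sup>+ x. ennreal (exp (- x)) * indicator {0..} x \<partial>lborel) = ennreal (0 - (- exp (- 0)))"
  proof (rule nn_integral_FTC_atLeast)
    show "((\<lambda>x :: real. - exp (- x)) \<longlongrightarrow> 0) at_top" by real_asymp
  qed (auto intro!: derivative_eq_intros)
  then show ?thesis by simp
qed

text \<open>\<open>c\<close> times the prefactor of \<open>dyck_max_exp_tail\<close> at rate
  \<open>a = c + 1\<close>. Decay at this rate beats the weight \<open>exp (c * x)\<close> and
  leaves \<open>exp (- x)\<close>, whose integral over \<open>{0..}\<close> is 1.\<close>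

definition dyck_exp_bound :: "real \<Rightarrow> real" where
  "dyck_exp_bound c = c * (2 * exp (2 * (c + 1) + (c + 1)\<^sup>2 / 4))"

lemma dyck_exp_majorant:
  assumes "0 < c"
  shows "(\<integral>\<^sup>+ x. ennreal (dyck_exp_bound c) * (ennreal (exp (- x)) * indicator {0..} x) \<partial>lborel)
           = ennreal (dyck_exp_bound c)"
  by (subst nn_integral_cmult) (simp_all add: exp_integral_1)

lemma dyck_exp_integrand_le:
  assumes n: "0 < n" and c: "0 < c"
  shows "ennreal (c * exp (c * x)) * indicator {0<..} x *
           ennreal (dyck_prob n {S. x * sqrt (real (2 * n)) < path_max S})
         \<le> ennreal (dyck_exp_bound c) * (ennreal (exp (- x)) * indicator {0..} x)"
proof (cases "0 < x")
  case True
  have "c * exp (c * x) * dyck_prob n {S. x * sqrt (real (2 * n)) < path_max S}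
      \<le> c * exp (c * x) * (2 * exp (2 * (c + 1) + (c + 1)\<^sup>2 / 4) * exp (- (c + 1) * x))"
    using True c n by (intro mult_left_mono dyck_max_exp_tail) auto
  also have "\<dots> = dyck_exp_bound c * (exp (c * x) * exp (- (c + 1) * x))"
    by (simp add: dyck_exp_bound_def mult_ac)
  also have "exp (c * x) * exp (- (c + 1) * x) = exp (- x)"
    by (simp add: algebra_simps flip: exp_add)
  finally show ?thesis using True c by (simp add: dyck_exp_bound_def flip: ennreal_mult)
qed simp

lemma dyck_expectation_exp:
  assumes n: "0 < n" and c: "0 < c"
  shows "ennreal (dyck_expectation (2 * n) (\<lambda>S. exp (c * (real_of_int (path_max S) / sqrt (real (2 * n)))))) =
    1 + (\<integral>\<^sup>+ x. ennreal (c * exp (c * x)) * indicator {0<..} x *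
           ennreal (dyck_prob n {S. x * sqrt (real (2 * n)) < path_max S}) \<partial>lborel)"
proof -
  let ?X = "\<lambda>S. real_of_int (path_max S) / sqrt (real (2 * n))"
  have event: "{S \<in> space (measure_pmf (dyck_pmf n)). x < ?X S} = {S. x * sqrt (real (2 * n)) < path_max S}" for x
    using n by (auto simp: less_divide_eq)
  have "finite (set_pmf (dyck_pmf n))" by (simp add: set_dyck_pmf finite_dyck_paths)
  then have "ennreal (dyck_expectation (2 * n) (\<lambda>S. exp (c * ?X S))) = (\<integral>\<^sup>+ S. ennreal (exp (c * ?X S)) \<partial>dyck_pmf n)"
    unfolding dyck_expectation_def dyck_pmf_def[symmetric]
    by (intro nn_integral_eq_integral[symmetric] integrable_measure_pmf_finite) auto
  also have "\<dots> = 1 + (\<integral>\<^sup>+ x. ennreal (c * exp (c * x)) * indicator {0<..} x *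
       ennreal (dyck_prob n {S \<in> space (measure_pmf (dyck_pmf n)). x < ?X S}) \<partial>lborel)"
  proof (rule measure_pmf.exp_layer_cake)
    show "AE S in measure_pmf (dyck_pmf n). 0 \<le> ?X S"
      by (auto simp: AE_measure_pmf_iff set_dyck_pmf dest: path_max_nonneg)
  qed (use c in auto)
  finally show ?thesis unfolding event .
qed

lemma dyck_expectation_exp_bound:
  assumes n: "0 < n" and c: "0 < c"
  shows "dyck_expectation (2 * n) (\<lambda>S. exp (c * (real_of_int (path_max S) / sqrt (real (2 * n))))) \<le> 1 + dyck_exp_bound c"
proof -
  have "ennreal (dyck_expectation (2 * n) (\<lambda>S. exp (c * (real_of_int (path_max S) / sqrt (real (2 * n))))))
      \<le> 1 + (\<integral>\<^sup>+ x. ennreal (dyck_exp_bound c) * (ennreal (exp (- x)) * indicator {0..} x) \<partial>lborel)"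
    unfolding dyck_expectation_exp[OF assms]
    by (intro add_left_mono nn_integral_mono dyck_exp_integrand_le assms)
  also have "\<dots> = ennreal (1 + dyck_exp_bound c)"
    unfolding dyck_exp_majorant[OF c] using c by (simp add: dyck_exp_bound_def ennreal_plus)
  finally show ?thesis
    using c by (subst (asm) ennreal_le_iff) (auto simp: dyck_exp_bound_def)
qed

section \<open>Passage to the limit in the exponential moments\<close>

context brownian_excursion
begin

text \<open>Dominated convergence in the layer-cake formula: the tails converge at continuity points
  of \<open>G\<close>, hence outside a countable set. The index \<open>Suc n\<close> avoids
  \<open>n = 0\<close>, where the scale \<open>sqrt (2 * n)\<close> is 0.\<close>

lemma exp_sup_limit:
  assumes c: "0 < c"
  shows "(\<lambda>n. ennreal (dyck_expectation (2 * Suc n) (\<lambda>S. exp (c * (real_of_int (path_max S) / sqrt (real (2 * Suc n)))))))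
      \<longlonglongrightarrow> (\<integral>\<^sup>+ \<omega>. ennreal (exp (c * sup_e \<omega>)) \<partial>M)"
proof -
  define G where "G x = prob {\<omega> \<in> space M. x < sup_e \<omega>}" for x
  define D where "D n x = dyck_prob n {S. x * sqrt (real (2 * n)) < path_max S}" for n x
  let ?f = "\<lambda>x. ennreal (c * exp (c * x)) * indicator {0<..} x"
  let ?w = "\<lambda>x. ennreal (dyck_exp_bound c) * (ennreal (exp (- x)) * indicator {0..} x)"
  have G: "antimono G"
    unfolding G_def by (intro antimonoI) (auto intro!: finite_measure_mono)
  then have "mono (\<lambda>x. - G x)" by (auto simp: monotone_def)
  then have "countable {x. \<not> isCont (\<lambda>x. - G x) x}"
    by (rule mono_ctble_discont)
  then have AE: "AE x in lborel. x \<notin> {x. \<not> isCont (\<lambda>x. - G x) x}"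
    by (intro AE_not_in countable_imp_null_set_lborel)
  have D: "antimono (D n)" for n
    unfolding D_def
  proof (intro antimonoI dyck_prob_mono)
    fix x y S assume "x \<le> (y :: real)" "S \<in> {S. y * sqrt (real (2 * n)) < path_max S}"
    moreover from this(1) have "x * sqrt (real (2 * n)) \<le> y * sqrt (real (2 * n))"
      by (intro mult_right_mono) auto
    ultimately show "S \<in> {S. x * sqrt (real (2 * n)) < path_max S}" by auto
  qed
  have [measurable]: "G \<in> borel_measurable borel" "\<And>n. D n \<in> borel_measurable borel"
    by (intro borel_measurable_antimono G D)+
  have "(\<lambda>n. \<integral>\<^sup>+ x. ?f x * ennreal (D (Suc n) x) \<partial>lborel) \<longlonglongrightarrow> (\<integral>\<^sup>+ x. ?f x * ennreal (G x) \<partial>lborel)"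
  proof (rule nn_integral_dominated_convergence[where w = ?w])
    show "(\<integral>\<^sup>+ x. ?w x \<partial>lborel) < \<infinity>"
      using c by (simp add: dyck_exp_majorant)
    show "AE x in lborel. ?f x * ennreal (D (Suc n) x) \<le> ?w x" for n
      unfolding D_def using c by (intro AE_I2 dyck_exp_integrand_le) auto
    show "AE x in lborel. (\<lambda>n. ?f x * ennreal (D (Suc n) x)) \<longlonglongrightarrow> ?f x * ennreal (G x)"
      using AE
    proof eventually_elim
      case (elim x)
      then have cont: "isCont G x" using isCont_minus[of x "\<lambda>x. - G x"] by simp
      show ?case
      proof (cases "0 < x")
        case True
        have "(\<lambda>n. D n x) \<longlonglongrightarrow> G x"
          using cont True unfolding D_def G_def by (intro max_exceeds_limit)
        then have "(\<lambda>n. D (Suc n) x) \<longlonglongrightarrow> G x" by (rule LIMSEQ_Suc)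
        then show ?thesis
          by (intro ennreal_tendsto_cmult tendsto_ennrealI) (simp_all add: True)
      qed simp
    qed
  qed measurable
  then have "(\<lambda>n. 1 + (\<integral>\<^sup>+ x. ?f x * ennreal (D (Suc n) x) \<partial>lborel)) \<longlonglongrightarrow> 1 + (\<integral>\<^sup>+ x. ?f x * ennreal (G x) \<partial>lborel)"
    by (intro tendsto_add tendsto_const)
  then show ?thesis
    unfolding exp_layer_cake[OF sup_e_measurable sup_e_nonneg c] dyck_expectation_exp[OF zero_less_Suc c] D_def G_def .
qed

text \<open>The uniform bound passes to the limit and makes the exponential moment of the excursion
  finite; convergence of extended values then becomes convergence of real expectations.\<close>

lemma exp_sup_expectation:
  assumes c: "0 < c"
  shows "integrable M (\<lambda>\<omega>. exp (c * sup_e \<omega>))"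
    and "(\<lambda>n. dyck_expectation (2 * n) (\<lambda>S. exp (c * (real_of_int (path_max S) / sqrt (real (2 * n))))))
           \<longlonglongrightarrow> expectation (\<lambda>\<omega>. exp (c * sup_e \<omega>))"
proof -
  let ?E = "\<lambda>n. dyck_expectation (2 * n) (\<lambda>S. exp (c * (real_of_int (path_max S) / sqrt (real (2 * n)))))"
  have "(\<integral>\<^sup>+ \<omega>. ennreal (exp (c * sup_e \<omega>)) \<partial>M) \<le> ennreal (1 + dyck_exp_bound c)"
    by (rule LIMSEQ_le_const2[OF exp_sup_limit[OF c]])
       (use dyck_expectation_exp_bound[OF zero_less_Suc c] in \<open>auto intro!: ennreal_leI\<close>)
  then have fin: "(\<integral>\<^sup>+ \<omega>. ennreal (exp (c * sup_e \<omega>)) \<partial>M) < \<infinity>"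
    using le_less_trans[OF _ ennreal_less_top] by auto
  show int: "integrable M (\<lambda>\<omega>. exp (c * sup_e \<omega>))"
    by (rule integrableI_nonneg) (use fin in auto)
  have nonneg: "0 \<le> ?E n" for n
    unfolding dyck_expectation_def by (intro integral_nonneg_AE) auto
  have "(\<integral>\<^sup>+ \<omega>. ennreal (exp (c * sup_e \<omega>)) \<partial>M) = ennreal (expectation (\<lambda>\<omega>. exp (c * sup_e \<omega>)))"
    by (rule nn_integral_eq_integral[OF int]) auto
  then have "(\<lambda>n. ennreal (?E (Suc n))) \<longlonglongrightarrow> ennreal (expectation (\<lambda>\<omega>. exp (c * sup_e \<omega>)))"
    using exp_sup_limit[OF c] by simp
  then have "(\<lambda>n. ?E (Suc n)) \<longlonglongrightarrow> expectation (\<lambda>\<omega>. exp (c * sup_e \<omega>))"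
    by (rule tendsto_ennrealD) (intro always_eventually allI nonneg, simp)
  then show "?E \<longlonglongrightarrow> expectation (\<lambda>\<omega>. exp (c * sup_e \<omega>))"
    by (rule LIMSEQ_imp_Suc)
qed

end

theorem theorem1:
  shows "(\<forall>(M :: 'a measure) (e :: real \<Rightarrow> 'a \<Rightarrow> real) (c :: real).
            normalized_brownian_excursion M e \<longrightarrow> 0 < c \<longrightarrow>
              integrable M (\<lambda>\<omega>. exp (c * (SUP t\<in>{0..1}. e t \<omega>))) \<and>
              (\<lambda>n. dyck_expectation (2 * n)
                      (\<lambda>S. exp (c * (real_of_int (path_max S) / sqrt (real (2 * n))))))
                \<longlonglongrightarrow> prob_space.expectation M (\<lambda>\<omega>. exp (c * (SUP t\<in>{0..1}. e t \<omega>)))) \<and>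
         (\<forall>c :: real. 0 < c \<longrightarrow>
            (SUP n\<in>{1..}. ereal (dyck_expectation (2 * n)
               (\<lambda>S. exp (c * (real n powr (- 1 / 2) * real_of_int (path_max S)))))) < \<infinity>)"
proof (intro conjI allI impI)
  fix M :: "'a measure" and e c
  assume "normalized_brownian_excursion M e" and c: "0 < (c :: real)"
  then interpret brownian_excursion M e
    by (intro brownian_excursion.intro brownian_excursion_axioms.intro) (simp_all add: normalized_brownian_excursion_def)
  show "integrable M (\<lambda>\<omega>. exp (c * (SUP t\<in>{0..1}. e t \<omega>)))"
    using exp_sup_expectation(1)[OF c] by (simp add: sup_e_def)
  show "(\<lambda>n. dyck_expectation (2 * n) (\<lambda>S. exp (c * (real_of_int (path_max S) / sqrt (real (2 * n))))))
          \<longlonglongrightarrow> prob_space.expectation M (\<lambda>\<omega>. exp (c * (SUP t\<in>{0..1}. e t \<omega>)))"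
    using exp_sup_expectation(2)[OF c] by (simp add: sup_e_def)
next
  fix c :: real assume c: "0 < c"
  have "(SUP n\<in>{1..}. ereal (dyck_expectation (2 * n)
      (\<lambda>S. exp (c * (real n powr (- 1 / 2) * real_of_int (path_max S)))))) \<le> ereal (1 + dyck_exp_bound (c * sqrt 2))"
  proof (rule SUP_least)
    fix n :: nat assume "n \<in> {1..}"
    then have n: "0 < n" by simp
    \<comment> \<open>Normalizing by \<open>sqrt n\<close> instead of \<open>sqrt (2 * n)\<close>
      amounts to replacing \<open>c\<close> by \<open>c * sqrt 2\<close>.\<close>
    have "real n powr (- 1 / 2) = 1 / sqrt (real n)"
      using n by (simp add: powr_minus powr_half_sqrt inverse_eq_divide)
    then have "c * (real n powr (- 1 / 2) * real_of_int (path_max S))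
        = (c * sqrt 2) * (real_of_int (path_max S) / sqrt (real (2 * n)))" for S
      using n by (simp add: real_sqrt_mult)
    then show "ereal (dyck_expectation (2 * n) (\<lambda>S. exp (c * (real n powr (- 1 / 2) * real_of_int (path_max S)))))
        \<le> ereal (1 + dyck_exp_bound (c * sqrt 2))"
      using dyck_expectation_exp_bound[OF n, of "c * sqrt 2"] c by simp
  qed
  also have "\<dots> < \<infinity>" by simp
  finally show "(SUP n\<in>{1..}. ereal (dyck_expectation (2 * n)
      (\<lambda>S. exp (c * (real n powr (- 1 / 2) * real_of_int (path_max S)))))) < \<infinity>" .
qed

end
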